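(* Let $\mathbf m,\mathbf n$ be strictly increasing sequences of positive integers. (i) If $\{i:i\in\mathbf m,\ i\notin\mathbf n\}$ is infinite, then there exists an ($\mathbf n$, almost greedy) basis (of some Banach space) that is not ($\mathbf m$, almost greedy). (ii) If $\{i:i\in\mathbf m,\ i\notin\mathbf n\}$ is finite, then every ($\mathbf n$, almost greedy) basis is ($\mathbf m$, almost greedy). (iii) For every sequence $\mathbf n$, there exists a $1$-($\mathbf n$, strong partially greedy) basis (of some Banach space) that is not ($\mathbf n$, almost greedy).
   Context: Banach spaces are separable, infinite-dimensional, over $\mathbb F=\mathbb R$ or $\mathbb C$; $\mathbb N=\{1,2,\dots\}$. A basis of $X$ is a sequence $\mathcal B=(e_n)_{n\ge1}\subset X$ whose linear span is norm-dense and for which there is a sequence $(e_n^* )_{n\ge1}\subset X^*$ with $e_j^*(e_k)=\delta_{j,k}$ and $0<\inf_n\{\|e_n\|,\|e_n^*\|\}\le\sup_n\{\|e_n\|,\|e_n^*\|\}<\infty$ (then $e_n^*(x)\to0$ for every $x$). Strictly increasing sequences $\mathbf n=(n_k)_{k\ge1}$ are identified with their sets of terms. For a finite set $A\subset\mathbb N$, $P_A(x)=\sum_{n\in A}e_n^*(x)e_n$. For $x\in X$, $m\in\mathbb N$, a greedy set of $x$ of order $m$ is a set $A\subset\mathbb N$ with $|A|=m$ and $\min_{n\in A}|e_n^*(x)|\ge\max_{n\notin A}|e_n^*(x)|$; $G_m(x)$ denotes $P_A(x)$ for such an $A$ (not necessarily unique). $\mathcal B$ is ($\mathbf n$, almost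 greedy) if there is $C\ge1$ with $\|x-G_m(x)\|\le C\,\widetilde\sigma^{\mathbf n}_m(x)$ for all $x\in X$, $m\in\mathbb N$ and all choices of $G_m(x)$, where $\widetilde\sigma^{\mathbf n}_m(x)=\inf\{\|x-P_A(x)\|:A\subset\mathbf n,\ |A|=m\}$. $\mathcal B$ is $1$-($\mathbf n$, strong partially greedy) if $\|x-G_m(x)\|\le\min_{0\le k\le m}\|x-P^{\mathbf n}_k(x)\|$ for all $x\in X$, $m\in\mathbb N$ and all choices of $G_m(x)$, where $P^{\mathbf n}_0(x)=0$ and $P^{\mathbf n}_k(x)=\sum_{i=1}^ke_{n_i}^*(x)e_{n_i}$. *)

theory Defs
  imports "HOL-Analysis.Analysis" "HOL-Library.Function_Algebras"
begin

text \<open>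
  Banach spaces are given by an explicit carrier: a linear subspace \<open>V\<close> of an abelian group
  \<open>'v\<close> with a scalar multiplication, together with a norm \<open>nrm\<close> of which only the values on
  \<open>V\<close> matter.  This allows quantifying over Banach spaces inside a formula, which type classes
  do not, and it allows both scalar fields.  Taking \<open>'v\<close> to be \<open>nat \<Rightarrow> 'k\<close>, with
  \<open>'k\<close> real or complex, loses no generality in an existence claim: a separable Banach space has
  algebraic dimension at most the continuum, which is the algebraic dimension of
  \<open>nat \<Rightarrow> 'k\<close>.
\<close>

locale normed_carrier = vector_space scale
  for scale :: "'k::real_normed_field \<Rightarrow> 'v::ab_group_add \<Rightarrow> 'v" +
  fixes V :: "'v set" and nrm :: "'v \<Rightarrow> real"
  assumes subspace_V: "subspace V"
    and nrm_nonneg: "x \<in> V \<Longrightarrow> 0 \<le> nrm x"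
    and nrm_eq_0_iff: "x \<in> V \<Longrightarrow> nrm x = 0 \<longleftrightarrow> x = 0"
    and nrm_triangle: "x \<in> V \<Longrightarrow> y \<in> V \<Longrightarrow> nrm (x + y) \<le> nrm x + nrm y"
    and nrm_scale: "x \<in> V \<Longrightarrow> nrm (scale c x) = norm c * nrm x"
begin

definition nrm_Cauchy :: "(nat \<Rightarrow> 'v) \<Rightarrow> bool" where
  "nrm_Cauchy s \<longleftrightarrow> (\<forall>\<epsilon>>0. \<exists>K. \<forall>i\<ge>K. \<forall>j\<ge>K. nrm (s i - s j) < \<epsilon>)"

definition nrm_dense :: "'v set \<Rightarrow> bool" where
  "nrm_dense D \<longleftrightarrow> D \<subseteq> V \<and> (\<forall>x\<in>V. \<forall>\<epsilon>>0. \<exists>d\<in>D. nrm (x - d) < \<epsilon>)"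

definition in_dual :: "('v \<Rightarrow> 'k) \<Rightarrow> bool" where
  "in_dual f \<longleftrightarrow>
     (\<forall>x\<in>V. \<forall>y\<in>V. f (x + y) = f x + f y) \<and>
     (\<forall>c. \<forall>x\<in>V. f (scale c x) = c * f x) \<and>
     (\<exists>K. \<forall>x\<in>V. norm (f x) \<le> K * nrm x)"

definition dual_nrm :: "('v \<Rightarrow> 'k) \<Rightarrow> real" where
  "dual_nrm f = (SUP x\<in>{x\<in>V. nrm x \<le> 1}. norm (f x))"

end

locale separable_banach_space = normed_carrier +
  assumes complete:
      "\<forall>s. (\<forall>i::nat. s i \<in> V) \<and> nrm_Cauchy s \<longrightarrow> (\<exists>x\<in>V. (\<lambda>i. nrm (s i - x)) \<longlonglongrightarrow> 0)"
    and separable: "\<exists>D. countable D \<and> nrm_dense D"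
    and infinite_dimensional: "\<nexists>B. finite B \<and> V \<subseteq> span B"

text \<open>
  All sequences are indexed by the positive integers; values at index \<open>0\<close> are irrelevant.
  The coordinate functionals \<open>es\<close> are a parameter; on \<open>V\<close> they are determined by \<open>e\<close>,
  by biorthogonality, continuity and density of the span.
\<close>

locale banach_basis = separable_banach_space +
  fixes e :: "nat \<Rightarrow> 'b" and es :: "nat \<Rightarrow> 'b \<Rightarrow> 'a"
  assumes e_in: "n \<ge> 1 \<Longrightarrow> e n \<in> V"
    and span_dense: "nrm_dense (span (e ` {1..}))"
    and es_dual: "n \<ge> 1 \<Longrightarrow> in_dual (es n)"
    and biorthogonal: "j \<ge> 1 \<Longrightarrow> k \<ge> 1 \<Longrightarrow> es j (e k) = (if j = k then 1 else 0)"
    and seminormalized_below: "0 < Inf (\<Union>n\<in>{1..}. {nrm (e n), dual_nrm (es n)})"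
    and seminormalized_above: "bdd_above (\<Union>n\<in>{1..}. {nrm (e n), dual_nrm (es n)})"

definition pos_index_seq :: "(nat \<Rightarrow> nat) \<Rightarrow> bool" where
  "pos_index_seq n \<longleftrightarrow> strict_mono_on {1..} n \<and> (\<forall>k\<ge>1. n k \<ge> 1)"

definition seq_terms :: "(nat \<Rightarrow> nat) \<Rightarrow> nat set" where
  "seq_terms n = n ` {1..}"

context banach_basis
begin

definition proj :: "nat set \<Rightarrow> 'b \<Rightarrow> 'b" where
  "proj A x = (\<Sum>i\<in>A. scale (es i x) (e i))"

definition greedy_set :: "'b \<Rightarrow> nat \<Rightarrow> nat set \<Rightarrow> bool" where
  "greedy_set x m A \<longleftrightarrow> A \<subseteq> {1..} \<and> finite A \<and> card A = m \<and>
     (\<forall>i\<in>A. \<forall>j\<in>{1..} - A. norm (es i x) \<ge> norm (es j x))"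

definition sigma_tilde :: "(nat \<Rightarrow> nat) \<Rightarrow> nat \<Rightarrow> 'b \<Rightarrow> real" where
  "sigma_tilde n m x = Inf {nrm (x - proj A x) | A. A \<subseteq> seq_terms n \<and> finite A \<and> card A = m}"

definition almost_greedy :: "(nat \<Rightarrow> nat) \<Rightarrow> bool" where
  "almost_greedy n \<longleftrightarrow> (\<exists>C\<ge>1. \<forall>x\<in>V. \<forall>m\<ge>1. \<forall>A. greedy_set x m A \<longrightarrow>
     nrm (x - proj A x) \<le> C * sigma_tilde n m x)"

definition partial_proj :: "(nat \<Rightarrow> nat) \<Rightarrow> nat \<Rightarrow> 'b \<Rightarrow> 'b" where
  "partial_proj n k x = (\<Sum>i=1..k. scale (es (n i) x) (e (n i)))"

definition one_strong_partially_greedy :: "(nat \<Rightarrow> nat) \<Rightarrow> bool" where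
  "one_strong_partially_greedy n \<longleftrightarrow> (\<forall>x\<in>V. \<forall>m\<ge>1. \<forall>A. greedy_set x m A \<longrightarrow>
     nrm (x - proj A x) \<le> (MIN k\<in>{0..m}. nrm (x - partial_proj n k x)))"

end

end

theory Submission
  imports Defs
begin

text \<open>
  Almost greediness relative to \<open>n\<close> tests the greedy residual against sets \<open>B\<close> of terms of
  \<open>n\<close>.

  If only finitely many terms of \<open>m\<close> lie outside \<open>n\<close>, then a set \<open>B\<close> of terms of \<open>m\<close> can be
  changed into a set of terms of \<open>n\<close> by replacing boundedly many indices with indices so far out
  that the coefficients there are negligible.  The coefficients that are put back into the residual
  are controlled by that residual as long as they lie outside the greedy set, because some index
  of the greedy set outside \<open>B\<close> carries a larger coefficient; indices outside \<open>n\<close> that \<open>B\<close>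
  shares with the greedy set can be deleted from the vector beforehand.  This is
  \<open>greedy_bound_with_extra_indices\<close>.

  Both examples are spaces with norm \<open>sup {(\<Sum>i\<in>F. norm (x i)) | F \<in> \<F>}\<close> for a family \<open>\<F>\<close> of
  finite sets containing the singletons, which are Banach spaces with the unit sequences as a
  basis.  If members of \<open>\<F>\<close> stay in \<open>\<F>\<close>, up to enlargement, when their part inside \<open>B\<close> is
  exchanged for at most as many indices outside \<open>B\<close>, then greedy sets of size at least \<open>card B\<close>
  leave a residual no larger than \<open>B\<close> does: the exchange trades coefficients in \<open>B\<close> for larger ones in the greedy set
  (\<open>greedy_le_exchangeable\<close>).  Almost greediness fails once there are disjoint sets of equal
  size, the second one consisting of terms of the sequence, whose indicators have norms of
  unbounded ratio (\<open>not_almost_greedyI\<close>).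

  When \<open>M\<close>, the set of terms of \<open>m\<close> outside \<open>n\<close>, is infinite, the space \<open>\<ell>\<^sub>1(M) \<oplus> c\<^sub>0\<close> separates
  the two sequences: every \<open>B\<close> disjoint from \<open>M\<close> admits the exchange, but indicators of subsets of
  \<open>M\<close> have far larger norm than those of sets of terms of \<open>n\<close>.  For the last claim a Schreier
  type family is used, in which a set is admissible if its size is at most the square root of the
  position, in the sequence \<open>n\<close>, of each term of \<open>n\<close> that it contains.  Initial segments of \<open>n\<close> admit the exchange, since it
  moves indices further out, but the indicator of an initial segment is much smaller than
  that of a block of the same length far out in the sequence.
\<close>

section \<open>Elementary facts about bases of Banach spaces\<close>

context normed_carrier
begin

lemma nrm_zero [simp]: "nrm 0 = 0"
  using nrm_eq_0_iff subspace_0[OF subspace_V] by blast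

lemma nrm_uminus: "x \<in> V \<Longrightarrow> nrm (- x) = nrm x"
  using nrm_scale[of x "- 1"] by simp

lemma nrm_diff_triangle: "x \<in> V \<Longrightarrow> y \<in> V \<Longrightarrow> nrm (x - y) \<le> nrm x + nrm y"
  using nrm_triangle[of x "- y"] nrm_uminus[of y] subspace_neg[OF subspace_V, of y] by simp

lemma nrm_sum_le:
  assumes "\<And>i. i \<in> A \<Longrightarrow> f i \<in> V"
  shows "nrm (sum f A) \<le> (\<Sum>i\<in>A. nrm (f i))"
  using assms
proof (induction A rule: infinite_finite_induct)
  case (insert i A)
  then have "nrm (f i + sum f A) \<le> nrm (f i) + nrm (sum f A)"
    by (intro nrm_triangle subspace_sum[OF subspace_V]) auto
  with insert show ?case by simp
qed auto

lemma in_dual_diff: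
  assumes "in_dual f" "x \<in> V" "y \<in> V"
  shows "f (x - y) = f x - f y"
proof -
  have "x - y \<in> V"
    using assms by (intro subspace_diff[OF subspace_V])
  then have "f ((x - y) + y) = f (x - y) + f y"
    using assms unfolding in_dual_def by blast
  then show ?thesis by simp
qed

lemma in_dual_zero: "in_dual f \<Longrightarrow> f 0 = 0"
  using in_dual_diff[of f 0 0] subspace_0[OF subspace_V] by simp

lemma in_dual_sum:
  assumes "in_dual f" "\<And>i. i \<in> A \<Longrightarrow> g i \<in> V"
  shows "f (sum g A) = (\<Sum>i\<in>A. f (g i))"
  using assms(2)
proof (induction A rule: infinite_finite_induct)
  case (insert i A)
  have "sum g A \<in> V"
    using insert by (intro subspace_sum[OF subspace_V]) auto
  then have "f (g i + sum g A) = f (g i) + f (sum g A)"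
    using assms(1) insert.prems unfolding in_dual_def by blast
  with insert show ?case by simp
qed (auto simp: in_dual_zero[OF assms(1)])

lemma norm_le_dual_nrm:
  assumes f: "in_dual f" and x: "x \<in> V"
  shows "norm (f x) \<le> dual_nrm f * nrm x"
proof (cases "x = 0")
  case True
  then show ?thesis by (simp add: in_dual_zero[OF f])
next
  case False
  obtain K where K: "\<And>y. y \<in> V \<Longrightarrow> norm (f y) \<le> K * nrm y"
    using f unfolding in_dual_def by blast
  have pos: "nrm x > 0"
    using False x nrm_nonneg[OF x] nrm_eq_0_iff[OF x] by linarith
  let ?y = "scale (of_real (inverse (nrm x))) x"
  have y: "?y \<in> V" "nrm ?y \<le> 1"
    using pos x by (auto simp: nrm_scale norm_inverse intro!: subspace_scale[OF subspace_V])
  have "norm (f z) \<le> \<bar>K\<bar>" if "z \<in> V" "nrm z \<le> 1" for z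
  proof -
    have "norm (f z) \<le> \<bar>K\<bar> * nrm z"
      using K[OF that(1)] mult_right_mono[of K "\<bar>K\<bar>" "nrm z"] nrm_nonneg[OF that(1)] by linarith
    also have "\<dots> \<le> \<bar>K\<bar> * 1"
      using that by (intro mult_left_mono) auto
    finally show ?thesis by simp
  qed
  then have "bdd_above ((\<lambda>z. norm (f z)) ` {z \<in> V. nrm z \<le> 1})"
    by (auto intro!: bdd_aboveI[of _ "\<bar>K\<bar>"])
  then have "norm (f ?y) \<le> dual_nrm f"
    unfolding dual_nrm_def using y by (intro cSUP_upper) auto
  moreover have "f ?y = of_real (inverse (nrm x)) * f x"
    using f x unfolding in_dual_def by blast
  ultimately have "inverse (nrm x) * norm (f x) \<le> dual_nrm f"
    using pos by (simp add: norm_mult norm_inverse)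
  then show ?thesis
    using pos by (simp add: field_simps)
qed

end

lemma pos_index_seq_terms:
  assumes "pos_index_seq n"
  shows "seq_terms n \<subseteq> {1..}" "inj_on n {1..}" "infinite (seq_terms n)"
proof -
  show "seq_terms n \<subseteq> {1..}"
    using assms by (auto simp: pos_index_seq_def seq_terms_def)
  show inj: "inj_on n {1..}"
    using assms by (auto simp: pos_index_seq_def strict_mono_on_imp_inj_on)
  then show "infinite (seq_terms n)"
    unfolding seq_terms_def by (metis finite_imageD infinite_Ici)
qed

context banach_basis
begin

lemma uniform_bound:
  obtains c where "c > 0" "\<And>i. i \<ge> 1 \<Longrightarrow> nrm (e i) \<le> c"
    "\<And>i x. i \<ge> 1 \<Longrightarrow> x \<in> V \<Longrightarrow> norm (es i x) \<le> c * nrm x"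
proof -
  obtain c0 where c0: "\<And>a. a \<in> (\<Union>i\<in>{1..}. {nrm (e i), dual_nrm (es i)}) \<Longrightarrow> a \<le> c0"
    using seminormalized_above unfolding bdd_above_def by blast
  show thesis
  proof (rule that[of "\<bar>c0\<bar> + 1"])
    fix i :: nat assume i: "i \<ge> 1"
    show "nrm (e i) \<le> \<bar>c0\<bar> + 1"
      using c0[of "nrm (e i)"] i by force
    fix x assume x: "x \<in> V"
    have "dual_nrm (es i) \<le> \<bar>c0\<bar> + 1"
      using c0[of "dual_nrm (es i)"] i by force
    then show "norm (es i x) \<le> (\<bar>c0\<bar> + 1) * nrm x"
      using norm_le_dual_nrm[OF es_dual[OF i] x] mult_right_mono[OF _ nrm_nonneg[OF x]]
      by (meson order_trans)
  qed auto
qed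

lemma scaled_e_in: "A \<subseteq> {1..} \<Longrightarrow> i \<in> A \<Longrightarrow> scale a (e i) \<in> V"
  by (intro subspace_scale[OF subspace_V] e_in) auto

lemma proj_in: "A \<subseteq> {1..} \<Longrightarrow> proj A x \<in> V"
  unfolding proj_def by (intro subspace_sum[OF subspace_V]) (rule scaled_e_in)

lemma es_proj:
  assumes "finite A" "A \<subseteq> {1..}" "j \<ge> 1"
  shows "es j (proj A x) = (if j \<in> A then es j x else 0)"
proof -
  have "es j (proj A x) = (\<Sum>i\<in>A. es j (scale (es i x) (e i)))"
    unfolding proj_def using assms by (intro in_dual_sum es_dual scaled_e_in)
  also have "\<dots> = (\<Sum>i\<in>A. if i = j then es i x else 0)"
  proof (rule sum.cong[OF refl])
    fix i assume "i \<in> A"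
    then have i: "i \<ge> 1"
      using assms(2) by auto
    have "es j (scale (es i x) (e i)) = es i x * es j (e i)"
      using es_dual[OF assms(3)] e_in[OF i] unfolding in_dual_def by blast
    then show "es j (scale (es i x) (e i)) = (if i = j then es i x else 0)"
      using biorthogonal[OF assms(3) i] by auto
  qed
  finally show ?thesis
    using assms(1) by simp
qed

lemma es_residual:
  assumes "finite A" "A \<subseteq> {1..}" "j \<ge> 1" "x \<in> V"
  shows "es j (x - proj A x) = (if j \<in> A then 0 else es j x)"
  using in_dual_diff[OF es_dual[OF assms(3)] assms(4) proj_in[OF assms(2)]] es_proj[OF assms(1-3)]
  by simp

lemma proj_cong: "(\<And>i. i \<in> A \<Longrightarrow> es i x = es i y) \<Longrightarrow> proj A x = proj A y"
  unfolding proj_def by (intro sum.cong) auto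

lemma proj_Un: "finite A \<Longrightarrow> finite B \<Longrightarrow> A \<inter> B = {} \<Longrightarrow> proj (A \<union> B) x = proj A x + proj B x"
  unfolding proj_def by (rule sum.union_disjoint)

lemma nrm_proj_le:
  assumes "A \<subseteq> {1..}"
  shows "nrm (proj A x) \<le> (\<Sum>i\<in>A. norm (es i x) * nrm (e i))"
proof -
  have "nrm (proj A x) \<le> (\<Sum>i\<in>A. nrm (scale (es i x) (e i)))"
    unfolding proj_def using scaled_e_in[OF assms] by (intro nrm_sum_le)
  also have "\<dots> = (\<Sum>i\<in>A. norm (es i x) * nrm (e i))"
    using assms e_in by (intro sum.cong) (auto simp: nrm_scale)
  finally show ?thesis .
qed

lemma partial_proj_eq_proj:
  assumes "pos_index_seq n"
  shows "partial_proj n k x = proj (n ` {1..k}) x"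
proof -
  have "inj_on n {1..k}"
    using pos_index_seq_terms(2)[OF assms] by (rule inj_on_subset) auto
  then show ?thesis
    unfolding proj_def partial_proj_def by (simp add: sum.reindex)
qed

text \<open>Finite combinations of basis vectors have eventually vanishing coefficients; they are dense
  and the coordinate functionals are equicontinuous, so the coefficients of any vector tend to \<open>0\<close>.\<close>

lemma coefficients_eventually_small:
  assumes x: "x \<in> V" and "\<epsilon> > 0"
  shows "\<exists>N. \<forall>i\<ge>N. i \<ge> 1 \<longrightarrow> norm (es i x) \<le> \<epsilon>"
proof -
  obtain c where c: "c > 0" "\<And>i x. i \<ge> 1 \<Longrightarrow> x \<in> V \<Longrightarrow> norm (es i x) \<le> c * nrm x"
    using uniform_bound by metis
  obtain d where d: "d \<in> span (e ` {1..})" "nrm (x - d) < \<epsilon> / c"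
    using span_dense x \<open>\<epsilon> > 0\<close> c(1) unfolding nrm_dense_def by (meson divide_pos_pos)
  have "d \<in> V \<and> (\<exists>N. \<forall>i\<ge>N. i \<ge> 1 \<longrightarrow> es i d = 0)"
    using d(1)
  proof (induction rule: span_induct_alt)
    case base
    show ?case
      using subspace_0[OF subspace_V] in_dual_zero[OF es_dual] by auto
  next
    case (step a b y)
    then obtain k where k: "k \<ge> 1" "b = e k"
      by auto
    obtain N where y: "y \<in> V" and N: "\<forall>i\<ge>N. i \<ge> 1 \<longrightarrow> es i y = 0"
      using step by blast
    have b: "b \<in> V" "scale a b \<in> V"
      using k e_in subspace_scale[OF subspace_V] by auto
    have "es i (scale a b + y) = 0" if "i \<ge> max N (k + 1)" "i \<ge> 1" for i
    proof -
      have "es i (scale a b + y) = a * es i b + es i y"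
        using es_dual[OF that(2)] b y unfolding in_dual_def by simp
      then show ?thesis
        using that k biorthogonal[of i k] N by simp
    qed
    then show ?case
      using b y subspace_add[OF subspace_V] by blast
  qed
  then obtain N where N: "d \<in> V" "\<forall>i\<ge>N. i \<ge> 1 \<longrightarrow> es i d = 0"
    by blast
  have "norm (es i x) \<le> \<epsilon>" if i: "i \<ge> N" "i \<ge> 1" for i
  proof -
    have "norm (es i x) = norm (es i (x - d))"
      using in_dual_diff[OF es_dual[OF i(2)] x N(1)] N(2) i by simp
    also have "\<dots> \<le> c * nrm (x - d)"
      using c(2)[OF i(2)] x N(1) subspace_diff[OF subspace_V] by blast
    also have "\<dots> \<le> \<epsilon>"
      using d(2) c(1) by (simp add: field_simps)
    finally show ?thesis .
  qed
  then show ?thesis by blast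
qed

lemma negligible_far_block:
  assumes x: "x \<in> V" and S: "infinite S" "S \<subseteq> {1..}" and "\<epsilon> > 0"
  obtains F where "F \<subseteq> S" "finite F" "card F = k" "nrm (proj F x) \<le> \<epsilon>"
proof -
  obtain c where c: "c > 0" "\<And>i. i \<ge> 1 \<Longrightarrow> nrm (e i) \<le> c"
    using uniform_bound by metis
  define \<delta> where "\<delta> = \<epsilon> / ((real k + 1) * c)"
  have \<delta>c: "\<delta> * c = \<epsilon> / (real k + 1)"
    using c(1) by (simp add: \<delta>_def)
  have "\<delta> > 0"
    using c \<open>\<epsilon> > 0\<close> by (simp add: \<delta>_def)
  then obtain N where N: "\<forall>i\<ge>N. i \<ge> 1 \<longrightarrow> norm (es i x) \<le> \<delta>"
    using coefficients_eventually_small[OF x] by blast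
  have "infinite (S - {..<N})"
    using S(1) by simp
  then obtain F where F: "finite F" "card F = k" "F \<subseteq> S - {..<N}"
    using infinite_arbitrarily_large by blast
  have "nrm (proj F x) \<le> (\<Sum>i\<in>F. norm (es i x) * nrm (e i))"
    using F S by (intro nrm_proj_le) auto
  also have "\<dots> \<le> (\<Sum>i\<in>F. \<delta> * c)"
  proof (intro sum_mono mult_mono)
    fix i assume "i \<in> F"
    then have "i \<ge> N" "i \<ge> 1"
      using F(3) S(2) by auto
    then show "norm (es i x) \<le> \<delta>" "nrm (e i) \<le> c" "0 \<le> nrm (e i)"
      using N c nrm_nonneg e_in by auto
  qed (use \<open>\<delta> > 0\<close> in auto)
  also have "\<dots> = real k * \<epsilon> / (real k + 1)"
    using F(2) \<delta>c by simp
  also have "\<dots> \<le> \<epsilon>"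
    using \<open>\<epsilon> > 0\<close> by (simp add: field_simps)
  finally show thesis
    using F that by blast
qed

lemma sigma_tilde_greatest:
  assumes "pos_index_seq n"
    and "\<And>B. B \<subseteq> seq_terms n \<Longrightarrow> finite B \<Longrightarrow> card B = k \<Longrightarrow> r \<le> nrm (x - proj B x)"
  shows "r \<le> sigma_tilde n k x"
  unfolding sigma_tilde_def
proof (rule cInf_greatest)
  obtain B where "B \<subseteq> seq_terms n" "finite B" "card B = k"
    using infinite_arbitrarily_large[OF pos_index_seq_terms(3)[OF assms(1)]] by metis
  then show "{nrm (x - proj A x) |A. A \<subseteq> seq_terms n \<and> finite A \<and> card A = k} \<noteq> {}"
    by blast
qed (use assms(2) in auto)

lemma sigma_tilde_le:
  assumes "pos_index_seq n" "x \<in> V" "B \<subseteq> seq_terms n" "finite B" "card B = k"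
  shows "sigma_tilde n k x \<le> nrm (x - proj B x)"
  unfolding sigma_tilde_def
proof (rule cInf_lower)
  show "bdd_below {nrm (x - proj A x) |A. A \<subseteq> seq_terms n \<and> finite A \<and> card A = k}"
    using assms(2) pos_index_seq_terms(1)[OF assms(1)]
    by (intro bdd_belowI[of _ 0])
      (auto intro!: nrm_nonneg subspace_diff[OF subspace_V] proj_in)
qed (use assms in blast)


section \<open>Finitely many new indices do not matter\<close>

text \<open>The indices outside \<open>n\<close> that \<open>A\<close> and \<open>B\<close> share are removed from \<open>x\<close> first, since
  nothing controls the coefficients there.  Every index of \<open>B\<close> that remains outside \<open>n\<close>
  lies outside the greedy set, so its coefficient is dominated by one in \<open>A - B\<close>, hence by the
  size of \<open>x - proj B x\<close>.  These indices, boundedly many, are traded for a block in \<open>n\<close> so far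
  out that it carries almost nothing.\<close>

lemma greedy_bound_with_extra_indices:
  assumes n: "pos_index_seq n" and C: "C \<ge> 1"
    and ag: "\<And>y k A. y \<in> V \<Longrightarrow> k \<ge> 1 \<Longrightarrow> greedy_set y k A \<Longrightarrow> nrm (y - proj A y) \<le> C * sigma_tilde n k y"
    and c: "c > 0" "\<And>i. i \<ge> 1 \<Longrightarrow> nrm (e i) \<le> c"
      "\<And>i x. i \<ge> 1 \<Longrightarrow> x \<in> V \<Longrightarrow> norm (es i x) \<le> c * nrm x"
    and x: "x \<in> V" and A: "greedy_set x k A"
    and B: "B \<subseteq> {1..}" "finite B" "card B = k" and D: "finite D" "B - seq_terms n \<subseteq> D"
  shows "nrm (x - proj A x) \<le> C * (1 + real (card D) * c\<^sup>2) * nrm (x - proj B x)"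
proof -
  define r where "r = nrm (x - proj B x)"
  have A': "A \<subseteq> {1..}" "finite A" "card A = k"
    and greedy: "\<And>i j. i \<in> A \<Longrightarrow> j \<in> {1..} - A \<Longrightarrow> norm (es j x) \<le> norm (es i x)"
    using A by (auto simp: greedy_set_def)
  have xB: "x - proj B x \<in> V"
    using x proj_in[OF B(1)] by (rule subspace_diff[OF subspace_V])
  have r0: "r \<ge> 0"
    unfolding r_def using xB by (rule nrm_nonneg)
  show ?thesis
  proof (cases "A = B")
    case True
    have "1 * 1 \<le> C * (1 + real (card D) * c\<^sup>2)"
      using C by (intro mult_mono) auto
    then show ?thesis
      using True r0 mult_right_mono[of 1 _ r] by (simp add: r_def)
  next
    case False
    (* A and B agree on E, so the residuals of A and B do not change when E is removed from x. *)
    define E where "E = A \<inter> B - seq_terms n"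
    define y where "y = x - proj E x"
    define A1 where "A1 = A - E"
    define B1 where "B1 = B - E"
    (* The indices that are traded for a far block of n. *)
    define G where "G = B1 - seq_terms n"
    have fin: "finite E" "finite A1" "finite B1" "finite G" "E \<subseteq> {1..}" "A1 \<subseteq> {1..}" "B1 \<subseteq> {1..}" "G \<subseteq> {1..}"
      using A' B by (auto simp: E_def A1_def B1_def G_def)
    have yV: "y \<in> V"
      unfolding y_def using x proj_in[OF fin(5)] by (rule subspace_diff[OF subspace_V])
    have esy: "es i y = (if i \<in> E then 0 else es i x)" if "i \<ge> 1" for i
      unfolding y_def using es_residual[OF fin(1,5) that x] .
    have "A = E \<union> A1" "E \<inter> A1 = {}" "B = E \<union> B1" "E \<inter> B1 = {}"
      by (auto simp: E_def A1_def B1_def)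
    moreover have "proj A1 y = proj A1 x" "proj B1 y = proj B1 x"
      using esy fin(6,7) by (auto intro!: proj_cong simp: A1_def B1_def)
    ultimately have resA: "y - proj A1 y = x - proj A x" and resB: "y - proj B1 y = x - proj B x"
      using proj_Un[of E A1 x] proj_Un[of E B1 x] fin by (auto simp: y_def)
    have cards: "card A1 = card B1"
    proof -
      have "E \<subseteq> A" "E \<subseteq> B"
        by (auto simp: E_def)
      then show ?thesis
        using A' B by (simp add: A1_def B1_def card_Diff_subset[OF fin(1)])
    qed
    have "A1 \<noteq> B1"
      using False by (auto simp: A1_def B1_def E_def)
    then have "\<not> A1 \<subseteq> B1"
      using card_subset_eq[OF fin(3)] cards by blast
    then obtain a where a: "a \<in> A1" "a \<notin> B1"
      by blast
    have k1: "card A1 \<ge> 1"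
      using a fin(2) by (metis One_nat_def Suc_leI card_gt_0_iff empty_iff)
    have gy: "greedy_set y (card A1) A1"
      unfolding greedy_set_def
    proof (intro conjI ballI)
      fix i j assume ij: "i \<in> A1" "j \<in> {1..} - A1"
      then show "norm (es j y) \<le> norm (es i y)"
        using esy[of i] esy[of j] greedy[of i j] A'(1) by (auto simp: A1_def)
    qed (use fin in auto)
    have Gsmall: "norm (es j y) * nrm (e j) \<le> c\<^sup>2 * r" if j: "j \<in> G" for j
    proof -
      have j1: "j \<in> {1..} - A1"
        using j fin(8) by (auto simp: G_def A1_def B1_def E_def)
      have a1: "a \<ge> 1"
        using a fin(6) by auto
      have "norm (es j y) \<le> norm (es a y)"
        using gy a j1 by (auto simp: greedy_set_def)
      also have "\<dots> = norm (es a (y - proj B1 y))"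
        using es_residual[OF fin(3,7) a1 yV] a by simp
      also have "\<dots> \<le> c * r"
        using c(3)[OF a1 xB] by (simp add: resB r_def)
      finally have "norm (es j y) * nrm (e j) \<le> (c * r) * c"
        using c(1,2) j1 r0 nrm_nonneg[OF e_in] by (intro mult_mono) auto
      then show ?thesis
        by (simp add: power2_eq_square mult_ac)
    qed
    have "card G \<le> card D"
      using D by (intro card_mono) (auto simp: G_def B1_def)
    then have nG: "nrm (proj G y) \<le> real (card D) * c\<^sup>2 * r"
      using order_trans[OF nrm_proj_le[OF fin(8)] sum_bounded_above[OF Gsmall]] r0
      by (simp add: mult_right_mono mult.assoc order_trans)
    show ?thesis
    proof (rule field_le_epsilon)
      fix \<epsilon> :: real assume "\<epsilon> > 0"
      obtain F where F: "F \<subseteq> seq_terms n - B1" "finite F" "card F = card G" "nrm (proj F y) \<le> \<epsilon> / C"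
      proof (rule negligible_far_block[OF yV])
        show "infinite (seq_terms n - B1)" "seq_terms n - B1 \<subseteq> {1..}"
          using pos_index_seq_terms[OF n] fin(3) by auto
        show "\<epsilon> / C > 0"
          using C \<open>\<epsilon> > 0\<close> by simp
      qed
      define H where "H = B1 - G"
      have H: "finite H" "H \<subseteq> seq_terms n" "H \<inter> F = {}" "H \<inter> G = {}" "B1 = H \<union> G"
        using fin F by (auto simp: H_def G_def)
      have Fpos: "F \<subseteq> {1..}"
        using F(1) pos_index_seq_terms(1)[OF n] by auto
      have "card (H \<union> F) = card B1"
        using H F fin by (simp add: card_Un_disjoint)
      then have "sigma_tilde n (card A1) y \<le> nrm (y - proj (H \<union> F) y)"
        using H F cards by (intro sigma_tilde_le[OF n yV]) auto
      also have "y - proj (H \<union> F) y = ((y - proj B1 y) + proj G y) - proj F y"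
        using proj_Un[of H F y] proj_Un[of H G y] H F fin by (simp add: algebra_simps)
      also have "nrm \<dots> \<le> nrm ((y - proj B1 y) + proj G y) + nrm (proj F y)"
        using xB by (intro nrm_diff_triangle subspace_add[OF subspace_V] proj_in fin Fpos) (simp add: resB)
      also have "\<dots> \<le> nrm (y - proj B1 y) + nrm (proj G y) + nrm (proj F y)"
        using xB by (intro add_right_mono nrm_triangle proj_in fin) (simp add: resB)
      also have "\<dots> \<le> r + real (card D) * c\<^sup>2 * r + \<epsilon> / C"
        using nG F(4) by (simp add: resB r_def)
      finally have "C * sigma_tilde n (card A1) y \<le> C * (r + real (card D) * c\<^sup>2 * r + \<epsilon> / C)"
        using C by (intro mult_left_mono) auto
      also have "\<dots> = C * (1 + real (card D) * c\<^sup>2) * r + \<epsilon>"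
        using C by (simp add: algebra_simps)
      finally show "nrm (x - proj A x) \<le> C * (1 + real (card D) * c\<^sup>2) * nrm (x - proj B x) + \<epsilon>"
        using ag[OF yV k1 gy] by (simp add: resA r_def)
    qed
  qed
qed

theorem almost_greedy_finite_difference:
  assumes m: "pos_index_seq m" and n: "pos_index_seq n"
    and fin: "finite (seq_terms m - seq_terms n)" and ag: "almost_greedy n"
  shows "almost_greedy m"
proof -
  obtain C where C: "C \<ge> 1"
    and agC: "\<And>y k A. y \<in> V \<Longrightarrow> k \<ge> 1 \<Longrightarrow> greedy_set y k A \<Longrightarrow> nrm (y - proj A y) \<le> C * sigma_tilde n k y"
    using ag unfolding almost_greedy_def by blast
  obtain c where c: "c > 0" "\<And>i. i \<ge> 1 \<Longrightarrow> nrm (e i) \<le> c"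
      "\<And>i x. i \<ge> 1 \<Longrightarrow> x \<in> V \<Longrightarrow> norm (es i x) \<le> c * nrm x"
    using uniform_bound by metis
  define K where "K = C * (1 + real (card (seq_terms m - seq_terms n)) * c\<^sup>2)"
  have "1 * 1 \<le> K"
    unfolding K_def using C by (intro mult_mono) auto
  then have K: "K \<ge> 1" by simp
  have "nrm (x - proj A x) \<le> K * sigma_tilde m k x"
    if x: "x \<in> V" and A: "greedy_set x k A" for x k A
  proof -
    have "nrm (x - proj A x) / K \<le> sigma_tilde m k x"
    proof (rule sigma_tilde_greatest[OF m])
      fix B assume B: "B \<subseteq> seq_terms m" "finite B" "card B = k"
      have "B \<subseteq> {1..}"
        using B(1) pos_index_seq_terms(1)[OF m] by blast
      then have "nrm (x - proj A x) \<le> K * nrm (x - proj B x)"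
        unfolding K_def using B fin
        by (intro greedy_bound_with_extra_indices[OF n C agC c x A]) auto
      then show "nrm (x - proj A x) / K \<le> nrm (x - proj B x)"
        using K by (simp add: field_simps)
    qed
    then show ?thesis
      using K by (simp add: field_simps)
  qed
  with K show ?thesis
    unfolding almost_greedy_def by blast
qed

end


section \<open>The Banach space of a family of finite sets\<close>

text \<open>Norms of the form \<open>x \<mapsto> sup {(\<Sum>i\<in>F. norm (x i)) | F \<in> \<F>}\<close> turn greedy inequalities into
  combinatorics of the family \<open>\<F>\<close>.  The singletons make the norm dominate every coordinate, which
  gives definiteness and continuous coordinate functionals.\<close>

locale index_family =
  fixes \<F> :: "nat set set"
  assumes finite_member: "F \<in> \<F> \<Longrightarrow> finite F"
    and member_pos: "F \<in> \<F> \<Longrightarrow> F \<subseteq> {1..}"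
    and singleton_member: "i \<ge> 1 \<Longrightarrow> {i} \<in> \<F>"
begin

definition pointwise_scale :: "'k::real_normed_field \<Rightarrow> (nat \<Rightarrow> 'k) \<Rightarrow> nat \<Rightarrow> 'k" where
  "pointwise_scale c x = (\<lambda>i. c * x i)"

definition unit_seq :: "nat \<Rightarrow> nat \<Rightarrow> 'k::real_normed_field" where
  "unit_seq k = (\<lambda>i. if i = k then 1 else 0)"

definition coord :: "nat \<Rightarrow> (nat \<Rightarrow> 'k::real_normed_field) \<Rightarrow> 'k" where
  "coord i x = x i"

definition family_norm :: "(nat \<Rightarrow> 'k::real_normed_field) \<Rightarrow> real" where
  "family_norm x = (SUP F\<in>\<F>. \<Sum>i\<in>F. norm (x i))"

text \<open>The closure of the finitely supported sequences, described through the norms of tails.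
  Index \<open>0\<close> lies in no member of the family, so the norm is definite only on sequences that
  vanish there.\<close>

definition family_space :: "(nat \<Rightarrow> 'k::real_normed_field) set" where
  "family_space = {x. x 0 = 0 \<and> (\<forall>\<epsilon>>0. \<exists>N. \<forall>F\<in>\<F>. (\<Sum>i\<in>F \<inter> {N..}. norm (x i)) \<le> \<epsilon>)}"

lemma family_nonempty: "\<F> \<noteq> {}"
  using singleton_member[of 1] by auto

lemma small_tail:
  assumes "x \<in> family_space" "\<epsilon> > 0"
  obtains N where "\<And>F. F \<in> \<F> \<Longrightarrow> (\<Sum>i\<in>F \<inter> {N..}. norm (x i)) \<le> \<epsilon>"
  using assms unfolding family_space_def by blast

lemma family_sums_bounded:
  fixes x :: "nat \<Rightarrow> 'k::real_normed_field"
  assumes "x \<in> family_space"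
  shows "bdd_above ((\<lambda>F. \<Sum>i\<in>F. norm (x i)) ` \<F>)"
proof -
  obtain N where N: "\<And>F. F \<in> \<F> \<Longrightarrow> (\<Sum>i\<in>F \<inter> {N..}. norm (x i)) \<le> 1"
    using small_tail[OF assms, of 1] by auto
  have "(\<Sum>i\<in>F. norm (x i)) \<le> (\<Sum>i<N. norm (x i)) + 1" if F: "F \<in> \<F>" for F
  proof -
    have "(\<Sum>i\<in>F. norm (x i)) = (\<Sum>i\<in>(F \<inter> {..<N}) \<union> (F \<inter> {N..}). norm (x i))"
      by (intro sum.cong) auto
    also have "\<dots> = (\<Sum>i\<in>F \<inter> {..<N}. norm (x i)) + (\<Sum>i\<in>F \<inter> {N..}. norm (x i))"
      using finite_member[OF F] by (intro sum.union_disjoint) auto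
    also have "(\<Sum>i\<in>F \<inter> {..<N}. norm (x i)) \<le> (\<Sum>i<N. norm (x i))"
      by (intro sum_mono2) auto
    finally show ?thesis
      using N[OF F] by linarith
  qed
  then show ?thesis
    by (auto intro!: bdd_aboveI2)
qed

lemma sum_le_family_norm:
  fixes x :: "nat \<Rightarrow> 'k::real_normed_field"
  assumes "x \<in> family_space" "F \<in> \<F>" "G \<subseteq> F"
  shows "(\<Sum>i\<in>G. norm (x i)) \<le> family_norm x"
proof -
  have "(\<Sum>i\<in>G. norm (x i)) \<le> (\<Sum>i\<in>F. norm (x i))"
    using assms(3) finite_member[OF assms(2)] by (intro sum_mono2) auto
  also have "\<dots> \<le> family_norm x"
    unfolding family_norm_def using family_sums_bounded[OF assms(1)] assms(2)
    by (intro cSUP_upper)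
  finally show ?thesis .
qed

lemma family_norm_least:
  assumes "\<And>F. F \<in> \<F> \<Longrightarrow> (\<Sum>i\<in>F. norm (x i)) \<le> r"
  shows "family_norm x \<le> r"
  unfolding family_norm_def using family_nonempty assms by (rule cSUP_least)

lemma coord_le_family_norm:
  fixes x :: "nat \<Rightarrow> 'k::real_normed_field"
  assumes "x \<in> family_space"
  shows "norm (x i) \<le> family_norm x"
proof (cases "i = 0")
  case True
  then show ?thesis
    using sum_le_family_norm[OF assms singleton_member[of 1], of "{}"] assms
    by (auto simp: family_space_def)
next
  case False
  then show ?thesis
    using sum_le_family_norm[OF assms singleton_member[of i] order_refl] by simp
qed

lemma family_space_finite_support:
  fixes x :: "nat \<Rightarrow> 'k::real_normed_field"
  assumes "x 0 = 0" "\<And>i. i \<ge> N \<Longrightarrow> x i = 0"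
  shows "x \<in> family_space"
proof -
  have "(\<Sum>i\<in>F \<inter> {N..}. norm (x i)) = 0" for F
    using assms(2) by (intro sum.neutral) auto
  then show ?thesis
    using assms(1) unfolding family_space_def by (auto intro!: exI[of _ N])
qed

lemma unit_seq_in: "k \<ge> 1 \<Longrightarrow> unit_seq k \<in> family_space"
  by (rule family_space_finite_support[of _ "Suc k"]) (auto simp: unit_seq_def)

sublocale vector_space "pointwise_scale :: 'k::real_normed_field \<Rightarrow> _"
  by unfold_locales (auto simp: pointwise_scale_def fun_eq_iff algebra_simps)

lemma subspace_family_space: "subspace (family_space :: (nat \<Rightarrow> 'k::real_normed_field) set)"
proof (rule subspaceI)
  show "0 \<in> (family_space :: (nat \<Rightarrow> 'k) set)"
    by (auto simp: family_space_def intro: less_imp_le)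
next
  fix x y :: "nat \<Rightarrow> 'k" assume xy: "x \<in> family_space" "y \<in> family_space"
  have "\<exists>N. \<forall>F\<in>\<F>. (\<Sum>i\<in>F \<inter> {N..}. norm ((x + y) i)) \<le> \<epsilon>" if "\<epsilon> > 0" for \<epsilon>
  proof -
    have half: "\<epsilon> / 2 > 0"
      using that by simp
    obtain N where N: "\<And>F. F \<in> \<F> \<Longrightarrow> (\<Sum>i\<in>F \<inter> {N..}. norm (x i)) \<le> \<epsilon> / 2"
      using small_tail[OF xy(1) half] by blast
    obtain M where M: "\<And>F. F \<in> \<F> \<Longrightarrow> (\<Sum>i\<in>F \<inter> {M..}. norm (y i)) \<le> \<epsilon> / 2"
      using small_tail[OF xy(2) half] by blast
    have "(\<Sum>i\<in>F \<inter> {max N M..}. norm ((x + y) i)) \<le> \<epsilon>" if F: "F \<in> \<F>" for F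
    proof -
      have "(\<Sum>i\<in>F \<inter> {max N M..}. norm ((x + y) i))
          \<le> (\<Sum>i\<in>F \<inter> {max N M..}. norm (x i)) + (\<Sum>i\<in>F \<inter> {max N M..}. norm (y i))"
        unfolding sum.distrib[symmetric] by (intro sum_mono) (simp add: norm_triangle_ineq)
      also have "\<dots> \<le> (\<Sum>i\<in>F \<inter> {N..}. norm (x i)) + (\<Sum>i\<in>F \<inter> {M..}. norm (y i))"
        using finite_member[OF F] by (intro add_mono sum_mono2) auto
      finally show ?thesis
        using N[OF F] M[OF F] by linarith
    qed
    then show ?thesis by blast
  qed
  then show "x + y \<in> family_space"
    using xy by (auto simp: family_space_def)
next
  fix c :: 'k and x :: "nat \<Rightarrow> 'k" assume x: "x \<in> family_space"
  have "\<exists>N. \<forall>F\<in>\<F>. (\<Sum>i\<in>F \<inter> {N..}. norm (pointwise_scale c x i)) \<le> \<epsilon>" if "\<epsilon> > 0" for \<epsilon>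
  proof -
    have "\<epsilon> / (norm c + 1) > 0"
      using that by (simp add: add_nonneg_pos)
    then obtain N where N: "\<And>F. F \<in> \<F> \<Longrightarrow> (\<Sum>i\<in>F \<inter> {N..}. norm (x i)) \<le> \<epsilon> / (norm c + 1)"
      using small_tail[OF x] by blast
    have "(\<Sum>i\<in>F \<inter> {N..}. norm (pointwise_scale c x i)) \<le> \<epsilon>" if F: "F \<in> \<F>" for F
    proof -
      have "(\<Sum>i\<in>F \<inter> {N..}. norm (pointwise_scale c x i)) = norm c * (\<Sum>i\<in>F \<inter> {N..}. norm (x i))"
        by (simp add: pointwise_scale_def norm_mult sum_distrib_left)
      also have "\<dots> \<le> (norm c + 1) * (\<epsilon> / (norm c + 1))"
        using N[OF F] by (intro mult_mono sum_nonneg) auto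
      also have "\<dots> = \<epsilon>"
        using norm_ge_zero[of c] by (simp add: add_nonneg_eq_0_iff)
      finally show ?thesis .
    qed
    then show ?thesis by blast
  qed
  then show "pointwise_scale c x \<in> family_space"
    using x by (auto simp: family_space_def pointwise_scale_def)
qed

lemma family_norm_scale_le:
  fixes x :: "nat \<Rightarrow> 'k::real_normed_field"
  assumes "x \<in> family_space"
  shows "family_norm (pointwise_scale c x) \<le> norm c * family_norm x"
proof (rule family_norm_least)
  fix F assume F: "F \<in> \<F>"
  have "(\<Sum>i\<in>F. norm (pointwise_scale c x i)) = norm c * (\<Sum>i\<in>F. norm (x i))"
    by (simp add: pointwise_scale_def norm_mult sum_distrib_left)
  then show "(\<Sum>i\<in>F. norm (pointwise_scale c x i)) \<le> norm c * family_norm x"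
    using sum_le_family_norm[OF assms F order_refl] by (simp add: mult_left_mono)
qed

sublocale normed_carrier "pointwise_scale :: 'k::real_normed_field \<Rightarrow> _" family_space family_norm
proof
  show "subspace (family_space :: (nat \<Rightarrow> 'k) set)"
    by (rule subspace_family_space)
next
  fix x :: "nat \<Rightarrow> 'k" assume x: "x \<in> family_space"
  show nonneg: "0 \<le> family_norm x"
    using order_trans[OF norm_ge_zero coord_le_family_norm[OF x]] .
  show "family_norm x = 0 \<longleftrightarrow> x = 0"
  proof
    assume "family_norm x = 0"
    then show "x = 0"
      using coord_le_family_norm[OF x] by (simp add: fun_eq_iff)
  next
    assume "x = 0"
    then have "family_norm x \<le> 0"
      by (intro family_norm_least) simp
    with nonneg show "family_norm x = 0" by simp
  qed
  fix c :: 'k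
  have "norm c * family_norm x \<le> family_norm (pointwise_scale c x)"
  proof (cases "c = 0")
    case True
    then show ?thesis
      using subspace_scale[OF subspace_family_space x, of c]
        order_trans[OF norm_ge_zero coord_le_family_norm] by fastforce
  next
    case False
    then have "family_norm x = family_norm (pointwise_scale (inverse c) (pointwise_scale c x))"
      by (simp add: pointwise_scale_def mult.assoc[symmetric])
    also have "\<dots> \<le> norm (inverse c) * family_norm (pointwise_scale c x)"
      by (intro family_norm_scale_le subspace_scale[OF subspace_family_space] x)
    finally show ?thesis
      using False by (simp add: norm_inverse norm_divide field_simps)
  qed
  then show "family_norm (pointwise_scale c x) = norm c * family_norm x"
    using family_norm_scale_le[OF x, of c] by linarith
next
  fix x y :: "nat \<Rightarrow> 'k" assume xy: "x \<in> family_space" "y \<in> family_space"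
  show "family_norm (x + y) \<le> family_norm x + family_norm y"
  proof (rule family_norm_least)
    fix F assume F: "F \<in> \<F>"
    have "(\<Sum>i\<in>F. norm ((x + y) i)) \<le> (\<Sum>i\<in>F. norm (x i)) + (\<Sum>i\<in>F. norm (y i))"
      unfolding sum.distrib[symmetric] by (intro sum_mono) (simp add: norm_triangle_ineq)
    then show "(\<Sum>i\<in>F. norm ((x + y) i)) \<le> family_norm x + family_norm y"
      using sum_le_family_norm[OF xy(1) F order_refl] sum_le_family_norm[OF xy(2) F order_refl]
      by linarith
  qed
qed

lemma truncation_close:
  fixes x :: "nat \<Rightarrow> 'k::real_normed_field"
  assumes "x \<in> family_space" "\<epsilon> > 0"
  obtains N where "family_norm (x - (\<lambda>i. if i < N then x i else 0)) \<le> \<epsilon>"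
proof -
  obtain N where N: "\<And>F. F \<in> \<F> \<Longrightarrow> (\<Sum>i\<in>F \<inter> {N..}. norm (x i)) \<le> \<epsilon>"
    using small_tail[OF assms] by blast
  have "family_norm (x - (\<lambda>i. if i < N then x i else 0)) \<le> \<epsilon>"
  proof (rule family_norm_least)
    fix F assume F: "F \<in> \<F>"
    have "(\<Sum>i\<in>F. norm ((x - (\<lambda>i. if i < N then x i else 0)) i)) = (\<Sum>i\<in>F \<inter> {N..}. norm (x i))"
      using finite_member[OF F] by (intro sum.mono_neutral_cong_right) auto
    then show "(\<Sum>i\<in>F. norm ((x - (\<lambda>i. if i < N then x i else 0)) i)) \<le> \<epsilon>"
      using N[OF F] by simp
  qed
  then show thesis
    using that by blast
qed

text \<open>Every inequality that defines the space and its norm involves finitely many coordinates, so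
  the coordinatewise limit of a Cauchy sequence inherits them.\<close>

lemma family_space_complete:
  fixes s :: "nat \<Rightarrow> nat \<Rightarrow> 'k::{real_normed_field, banach}"
  assumes s: "\<And>i. s i \<in> family_space" and cau: "nrm_Cauchy s"
  shows "\<exists>x\<in>family_space. (\<lambda>i. family_norm (s i - x)) \<longlonglongrightarrow> 0"
proof -
  note diff_in = subspace_diff[OF subspace_family_space]
  have "Cauchy (\<lambda>i. s i j)" for j
  proof (rule CauchyI)
    fix \<epsilon> :: real assume "\<epsilon> > 0"
    then obtain K where K: "\<forall>i\<ge>K. \<forall>l\<ge>K. family_norm (s i - s l) < \<epsilon>"
      using cau unfolding nrm_Cauchy_def by blast
    have "norm (s i j - s l j) < \<epsilon>" if "i \<ge> K" "l \<ge> K" for i l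
      using coord_le_family_norm[OF diff_in[OF s[of i] s[of l]], of j] K that by fastforce
    then show "\<exists>M. \<forall>m\<ge>M. \<forall>n\<ge>M. norm (s m j - s n j) < \<epsilon>"
      by blast
  qed
  then obtain x where x: "\<And>j. (\<lambda>i. s i j) \<longlonglongrightarrow> x j"
    unfolding Cauchy_convergent_iff convergent_def by metis
  have close: "\<exists>K. \<forall>i\<ge>K. \<forall>F\<in>\<F>. (\<Sum>j\<in>F. norm (s i j - x j)) \<le> \<epsilon>" if "\<epsilon> > 0" for \<epsilon>
  proof -
    obtain K where K: "\<forall>i\<ge>K. \<forall>l\<ge>K. family_norm (s i - s l) < \<epsilon>"
      using cau \<open>\<epsilon> > 0\<close> unfolding nrm_Cauchy_def by blast
    have "(\<Sum>j\<in>F. norm (s i j - x j)) \<le> \<epsilon>" if i: "i \<ge> K" and F: "F \<in> \<F>" for i F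
    proof (rule LIMSEQ_le_const2)
      show "(\<lambda>l. \<Sum>j\<in>F. norm (s i j - s l j)) \<longlonglongrightarrow> (\<Sum>j\<in>F. norm (s i j - x j))"
        by (intro tendsto_intros x)
      have "(\<Sum>j\<in>F. norm (s i j - s l j)) \<le> \<epsilon>" if l: "l \<ge> K" for l
        using sum_le_family_norm[OF diff_in[OF s[of i] s[of l]] F order_refl] K i l by fastforce
      then show "\<exists>N. \<forall>l\<ge>N. (\<Sum>j\<in>F. norm (s i j - s l j)) \<le> \<epsilon>"
        by blast
    qed
    then show ?thesis by blast
  qed
  have "x \<in> family_space"
  proof -
    have "x 0 = 0"
      using x[of 0] s by (simp add: family_space_def LIMSEQ_const_iff)
    moreover have "\<exists>N. \<forall>F\<in>\<F>. (\<Sum>j\<in>F \<inter> {N..}. norm (x j)) \<le> \<epsilon>" if "\<epsilon> > 0" for \<epsilon>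
    proof -
      obtain i where i: "\<And>F. F \<in> \<F> \<Longrightarrow> (\<Sum>j\<in>F. norm (s i j - x j)) \<le> \<epsilon> / 2"
        using close[of "\<epsilon> / 2"] \<open>\<epsilon> > 0\<close> by auto
      have "\<epsilon> / 2 > 0"
        using \<open>\<epsilon> > 0\<close> by simp
      then obtain N where N: "\<And>F. F \<in> \<F> \<Longrightarrow> (\<Sum>j\<in>F \<inter> {N..}. norm (s i j)) \<le> \<epsilon> / 2"
        using small_tail[OF s[of i]] by blast
      have "(\<Sum>j\<in>F \<inter> {N..}. norm (x j)) \<le> \<epsilon>" if F: "F \<in> \<F>" for F
      proof -
        have "(\<Sum>j\<in>F \<inter> {N..}. norm (x j))
            \<le> (\<Sum>j\<in>F \<inter> {N..}. norm (s i j)) + (\<Sum>j\<in>F \<inter> {N..}. norm (s i j - x j))"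
          unfolding sum.distrib[symmetric]
          by (intro sum_mono) (metis norm_triangle_sub add.commute norm_minus_commute)
        also have "(\<Sum>j\<in>F \<inter> {N..}. norm (s i j - x j)) \<le> (\<Sum>j\<in>F. norm (s i j - x j))"
          using finite_member[OF F] by (intro sum_mono2) auto
        finally show ?thesis
          using i[OF F] N[OF F] by linarith
      qed
      then show ?thesis by blast
    qed
    ultimately show ?thesis
      by (simp add: family_space_def)
  qed
  moreover have "(\<lambda>i. family_norm (s i - x)) \<longlonglongrightarrow> 0"
  proof (rule LIMSEQ_I)
    fix \<epsilon> :: real assume "\<epsilon> > 0"
    then obtain K where K: "\<forall>i\<ge>K. \<forall>F\<in>\<F>. (\<Sum>j\<in>F. norm (s i j - x j)) \<le> \<epsilon> / 2"
      using close[of "\<epsilon> / 2"] by auto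
    have "norm (family_norm (s i - x) - 0) < \<epsilon>" if "i \<ge> K" for i
    proof -
      have "family_norm (s i - x) \<le> \<epsilon> / 2"
        using K that by (intro family_norm_least) simp
      then show ?thesis
        using nrm_nonneg[OF diff_in[OF s[of i] \<open>x \<in> family_space\<close>]] \<open>\<epsilon> > 0\<close> by simp
    qed
    then show "\<exists>K. \<forall>i\<ge>K. norm (family_norm (s i - x) - 0) < \<epsilon>"
      by blast
  qed
  ultimately show ?thesis by blast
qed

lemma family_norm_finite_support_le:
  fixes x :: "nat \<Rightarrow> 'k::real_normed_field"
  assumes "\<And>i. i \<ge> N \<Longrightarrow> x i = 0" "\<And>i. norm (x i) \<le> \<delta>"
  shows "family_norm x \<le> real N * \<delta>"
proof (rule family_norm_least)
  fix F assume F: "F \<in> \<F>"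
  have "(\<Sum>i\<in>F. norm (x i)) = (\<Sum>i\<in>F \<inter> {..<N}. norm (x i))"
    using assms(1) finite_member[OF F] by (intro sum.mono_neutral_right) (auto simp: not_less)
  also have "\<dots> \<le> (\<Sum>i<N. norm (x i))"
    by (intro sum_mono2) auto
  also have "\<dots> \<le> real N * \<delta>"
    using sum_bounded_above[of "{..<N}" "\<lambda>i. norm (x i)" \<delta>] assms(2) by simp
  finally show "(\<Sum>i\<in>F. norm (x i)) \<le> real N * \<delta>" .
qed

text \<open>A vector is first truncated and then its finitely many coordinates are moved into a countable
  dense set of scalars.\<close>

lemma family_space_separable:
  "\<exists>D :: (nat \<Rightarrow> 'k::{real_normed_field, second_countable_topology}) set. countable D \<and> nrm_dense D"
proof -
  obtain Q :: "'k set" where Q: "countable Q" "\<And>X. open X \<Longrightarrow> X \<noteq> {} \<Longrightarrow> \<exists>d\<in>Q. d \<in> X"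
    using countable_dense_setE by blast
  define D :: "(nat \<Rightarrow> 'k) set"
    where "D = (\<lambda>l i. if 0 < i \<and> i < length l then l ! i else 0) ` lists Q"
  have "countable D"
    unfolding D_def using Q(1) by (intro countable_image countable_lists)
  moreover have "D \<subseteq> family_space"
    unfolding D_def
  proof (intro image_subsetI)
    show "(\<lambda>i. if 0 < i \<and> i < length l then l ! i else 0) \<in> family_space" for l :: "'k list"
      by (rule family_space_finite_support[of _ "length l"]) auto
  qed
  moreover have "\<exists>d\<in>D. family_norm (x - d) < \<epsilon>"
    if x: "x \<in> family_space" and "\<epsilon> > 0" for x :: "nat \<Rightarrow> 'k" and \<epsilon>
  proof -
    have "\<epsilon> / 2 > 0"
      using \<open>\<epsilon> > 0\<close> by simp
    then obtain N where N: "family_norm (x - (\<lambda>i. if i < N then x i else 0)) \<le> \<epsilon> / 2"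
      using truncation_close[OF x] by blast
    define t where "t = (\<lambda>i. if i < N then x i else 0)"
    define \<delta> where "\<delta> = \<epsilon> / (2 * (real N + 1))"
    have "\<delta> > 0"
      using \<open>\<epsilon> > 0\<close> by (simp add: \<delta>_def)
    then have "\<exists>q\<in>Q. dist (x i) q < \<delta>" for i
      using Q(2)[of "ball (x i) \<delta>"] by auto
    then obtain q where q: "\<And>i. q i \<in> Q" "\<And>i. dist (x i) (q i) < \<delta>"
      by metis
    define d where "d = (\<lambda>i. if 0 < i \<and> i < N then q i else 0)"
    have "d = (\<lambda>i. if 0 < i \<and> i < length (map q [0..<N]) then map q [0..<N] ! i else 0)"
      by (auto simp: d_def fun_eq_iff)
    moreover have "map q [0..<N] \<in> lists Q"
      using q(1) by auto
    ultimately have "d \<in> D"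
      unfolding D_def by blast
    have "x 0 = 0"
      using x by (simp add: family_space_def)
    then have "t \<in> family_space" "d \<in> family_space"
      by (auto simp: t_def d_def intro: family_space_finite_support[of _ N])
    then have "family_norm ((x - t) + (t - d)) \<le> family_norm (x - t) + family_norm (t - d)"
      using x by (intro nrm_triangle subspace_diff[OF subspace_family_space])
    moreover have "family_norm (t - d) \<le> real N * \<delta>"
      using q(2) \<open>\<delta> > 0\<close> \<open>x 0 = 0\<close>
      by (intro family_norm_finite_support_le) (auto simp: t_def d_def dist_norm less_imp_le)
    moreover have "real N * \<delta> < \<epsilon> / 2"
      using \<open>\<epsilon> > 0\<close> by (simp add: \<delta>_def field_simps)
    ultimately have "family_norm (x - d) < \<epsilon>"
      using N by (simp add: t_def)
    with \<open>d \<in> D\<close> show ?thesis by blast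
  qed
  ultimately show ?thesis
    unfolding nrm_dense_def by blast
qed

text \<open>This makes the unit sequences linearly independent.\<close>

lemma span_units_vanish:
  assumes "x \<in> span (unit_seq ` S)" "i \<notin> S"
  shows "x i = 0"
  using assms(1)
  by (induction rule: span_induct_alt) (use assms(2) in \<open>auto simp: pointwise_scale_def unit_seq_def split: if_splits\<close>)

lemma family_space_infinite_dimensional:
  "\<nexists>B :: (nat \<Rightarrow> 'k::real_normed_field) set. finite B \<and> family_space \<subseteq> span B"
proof
  assume "\<exists>B :: (nat \<Rightarrow> 'k) set. finite B \<and> family_space \<subseteq> span B"
  then obtain B :: "(nat \<Rightarrow> 'k) set" where B: "finite B" "family_space \<subseteq> span B"
    by blast
  have inj: "inj (unit_seq :: nat \<Rightarrow> nat \<Rightarrow> 'k)"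
    by (auto simp: inj_def unit_seq_def fun_eq_iff split: if_splits)
  have "independent (unit_seq ` {1..} :: (nat \<Rightarrow> 'k) set)"
    unfolding dependent_def
  proof safe
    fix k :: nat
    assume "(unit_seq k :: nat \<Rightarrow> 'k) \<in> span (unit_seq ` {1..} - {unit_seq k})"
    also have "unit_seq ` {1..} - {unit_seq k} = (unit_seq ` ({1..} - {k}) :: (nat \<Rightarrow> 'k) set)"
      using inj by (auto simp: inj_def)
    finally have "(unit_seq k :: nat \<Rightarrow> 'k) k = 0"
      by (rule span_units_vanish) simp
    then show False
      by (simp add: unit_seq_def)
  qed
  moreover have "(unit_seq ` {1..} :: (nat \<Rightarrow> 'k) set) \<subseteq> span B"
    using unit_seq_in B(2) by force
  ultimately have "finite (unit_seq ` {1..} :: (nat \<Rightarrow> 'k) set)"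
    using independent_span_bound[OF B(1)] by blast
  then show False
    using finite_imageD inj_on_subset[OF inj subset_UNIV] infinite_Ici by blast
qed

lemma finite_support_in_span:
  fixes x :: "nat \<Rightarrow> 'k::real_normed_field"
  assumes "x 0 = 0" "\<And>i. i \<ge> N \<Longrightarrow> x i = 0"
  shows "x \<in> span (unit_seq ` {1..})"
proof -
  have *: "(\<Sum>k\<in>A. pointwise_scale (x k) (unit_seq k)) i = (\<Sum>k\<in>A. x k * unit_seq k i)" for A i
    by (induction A rule: infinite_finite_induct) (auto simp: pointwise_scale_def)
  have "x = (\<Sum>k\<in>{1..<N}. pointwise_scale (x k) (unit_seq k))"
  proof
    fix i
    have "(\<Sum>k\<in>{1..<N}. x k * unit_seq k i) = (\<Sum>k\<in>{1..<N}. if k = i then x k else 0)"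
      by (intro sum.cong) (auto simp: unit_seq_def)
    also have "\<dots> = x i"
      using assms by (auto simp: not_less Suc_le_eq)
    finally show "x i = (\<Sum>k\<in>{1..<N}. pointwise_scale (x k) (unit_seq k)) i"
      unfolding * ..
  qed
  moreover have "(\<Sum>k\<in>{1..<N}. pointwise_scale (x k) (unit_seq k)) \<in> span (unit_seq ` {1..})"
    by (intro span_sum span_scale span_base) auto
  ultimately show ?thesis by simp
qed

lemma span_units_dense: "nrm_dense (span (unit_seq ` {1..} :: (nat \<Rightarrow> 'k::real_normed_field) set))"
  unfolding nrm_dense_def
proof (intro conjI ballI allI impI)
  show "span (unit_seq ` {1..}) \<subseteq> (family_space :: (nat \<Rightarrow> 'k) set)"
    using unit_seq_in by (intro span_minimal subspace_family_space) auto
  fix x :: "nat \<Rightarrow> 'k" and \<epsilon> :: real assume x: "x \<in> family_space" and "\<epsilon> > 0"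
  then obtain N where N: "family_norm (x - (\<lambda>i. if i < N then x i else 0)) \<le> \<epsilon> / 2"
    using truncation_close[OF x, of "\<epsilon> / 2"] by auto
  moreover have "(\<lambda>i. if i < N then x i else 0) \<in> span (unit_seq ` {1..})"
    using x by (intro finite_support_in_span[of _ N]) (auto simp: family_space_def)
  ultimately show "\<exists>d\<in>span (unit_seq ` {1..}). family_norm (x - d) < \<epsilon>"
    using \<open>\<epsilon> > 0\<close> by (intro bexI[of _ "\<lambda>i. if i < N then x i else 0"]) auto
qed

lemma family_norm_unit_seq:
  assumes "k \<ge> 1"
  shows "family_norm (unit_seq k :: nat \<Rightarrow> 'k::real_normed_field) = 1"
proof (rule antisym)
  show "family_norm (unit_seq k :: nat \<Rightarrow> 'k) \<le> 1"
  proof (rule family_norm_least)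
    fix F assume F: "F \<in> \<F>"
    have "(\<Sum>i\<in>F. norm ((unit_seq k :: nat \<Rightarrow> 'k) i)) = (\<Sum>i\<in>F. if i = k then 1 else 0)"
      by (intro sum.cong) (auto simp: unit_seq_def)
    then show "(\<Sum>i\<in>F. norm ((unit_seq k :: nat \<Rightarrow> 'k) i)) \<le> 1"
      using finite_member[OF F] by simp
  qed
  show "1 \<le> family_norm (unit_seq k :: nat \<Rightarrow> 'k)"
    using coord_le_family_norm[OF unit_seq_in[OF assms], of k] by (simp add: unit_seq_def)
qed

lemma in_dual_coord: "in_dual (coord i :: (nat \<Rightarrow> 'k::real_normed_field) \<Rightarrow> 'k)"
  unfolding in_dual_def
  using coord_le_family_norm by (auto simp: coord_def pointwise_scale_def intro!: exI[of _ 1])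

lemma dual_nrm_coord:
  assumes "i \<ge> 1"
  shows "dual_nrm (coord i :: (nat \<Rightarrow> 'k::real_normed_field) \<Rightarrow> 'k) = 1"
  unfolding dual_nrm_def
proof (rule cSup_eq_maximum)
  have unit: "(unit_seq i :: nat \<Rightarrow> 'k) \<in> {x \<in> family_space. family_norm x \<le> 1}"
    by (simp add: family_norm_unit_seq[OF assms] unit_seq_in[OF assms])
  have "1 = norm (coord i (unit_seq i :: nat \<Rightarrow> 'k))"
    by (simp add: coord_def unit_seq_def)
  then show "1 \<in> (\<lambda>x :: nat \<Rightarrow> 'k. norm (coord i x)) ` {x \<in> family_space. family_norm x \<le> 1}"
    using unit by (rule image_eqI)
qed (use order_trans[OF coord_le_family_norm] in \<open>auto simp: coord_def\<close>)

sublocale banach_basis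
  "pointwise_scale :: 'k::{real_normed_field, banach, second_countable_topology} \<Rightarrow> _"
  family_space family_norm unit_seq coord
proof
  have "(\<Union>n\<in>{1..}. {family_norm (unit_seq n :: nat \<Rightarrow> 'k), dual_nrm (coord n :: _ \<Rightarrow> 'k)}) = {1}"
    using family_norm_unit_seq dual_nrm_coord by auto
  then show "0 < Inf (\<Union>n\<in>{1..}. {family_norm (unit_seq n :: nat \<Rightarrow> 'k), dual_nrm (coord n :: _ \<Rightarrow> 'k)})"
    and "bdd_above (\<Union>n\<in>{1..}. {family_norm (unit_seq n :: nat \<Rightarrow> 'k), dual_nrm (coord n :: _ \<Rightarrow> 'k)})"
    by simp_all
  show "coord j (unit_seq k :: nat \<Rightarrow> 'k) = (if j = k then 1 else 0)" for j k
    by (simp add: coord_def unit_seq_def)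
qed (use family_space_complete family_space_separable family_space_infinite_dimensional unit_seq_in
      span_units_dense in_dual_coord in blast)+

lemma coord_residual:
  fixes x :: "nat \<Rightarrow> 'k::{real_normed_field, banach, second_countable_topology}"
  assumes "finite A" "A \<subseteq> {1..}" "x \<in> family_space"
  shows "(x - proj A x) i = (if i \<in> A then 0 else x i)"
proof (cases "i \<ge> 1")
  case True
  then show ?thesis
    using es_residual[OF assms(1,2) True assms(3)] by (simp add: coord_def)
next
  case False
  have "x - proj A x \<in> family_space"
    using assms by (intro subspace_diff[OF subspace_family_space] proj_in)
  then show ?thesis
    using False assms by (auto simp: family_space_def not_le)
qed

lemma residual_norm_least:
  fixes x :: "nat \<Rightarrow> 'k::{real_normed_field, banach, second_countable_topology}"
  assumes "finite A" "A \<subseteq> {1..}" "x \<in> family_space"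
    and "\<And>F. F \<in> \<F> \<Longrightarrow> (\<Sum>i\<in>F - A. norm (x i)) \<le> r"
  shows "family_norm (x - proj A x) \<le> r"
proof (rule family_norm_least)
  fix F assume F: "F \<in> \<F>"
  have "(\<Sum>i\<in>F. norm ((x - proj A x) i)) = (\<Sum>i\<in>F - A. norm (x i))"
    using finite_member[OF F] coord_residual[OF assms(1-3)]
    by (intro sum.mono_neutral_cong_right) auto
  then show "(\<Sum>i\<in>F. norm ((x - proj A x) i)) \<le> r"
    using assms(4)[OF F] by simp
qed

lemma sum_le_residual_norm:
  fixes x :: "nat \<Rightarrow> 'k::{real_normed_field, banach, second_countable_topology}"
  assumes "finite A" "A \<subseteq> {1..}" "x \<in> family_space" "F \<in> \<F>" "G \<subseteq> F" "G \<inter> A = {}"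
  shows "(\<Sum>i\<in>G. norm (x i)) \<le> family_norm (x - proj A x)"
proof -
  have "(\<Sum>i\<in>G. norm (x i)) = (\<Sum>i\<in>G. norm ((x - proj A x) i))"
    using assms(6) coord_residual[OF assms(1-3)] by (intro sum.cong) auto
  also have "\<dots> \<le> family_norm (x - proj A x)"
    using assms(3-5) by (intro sum_le_family_norm subspace_diff[OF subspace_family_space] proj_in assms(2))
  finally show ?thesis .
qed


section \<open>Exchange property and greedy approximation\<close>

text \<open>This is a spreading property relative to \<open>B\<close>.  Only a superset \<open>G\<close> is asked for, so that the
  family need not be closed under subsets.\<close>

definition exchangeable :: "nat set \<Rightarrow> bool" where
  "exchangeable B \<longleftrightarrow> (\<forall>F\<in>\<F>. \<forall>H. H \<subseteq> {1..} - B \<longrightarrow> finite H \<longrightarrow> card H \<le> card (F \<inter> B) \<longrightarrow>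
     (\<exists>G\<in>\<F>. (F - B) \<union> H \<subseteq> G))"

text \<open>A sum over \<open>F - A\<close> splits into \<open>F - A - B\<close>, which \<open>x - proj B x\<close> sees, and \<open>(F \<inter> B) - A\<close>,
  which it does not.  The latter has at most as many elements as \<open>A - B\<close>, where the coefficients
  are larger because \<open>A\<close> is greedy; exchanging the one for the other keeps the sum admissible.\<close>

lemma greedy_le_exchangeable:
  fixes x :: "nat \<Rightarrow> 'k::{real_normed_field, banach, second_countable_topology}"
  assumes x: "x \<in> family_space" and A: "greedy_set x k A"
    and B: "finite B" "B \<subseteq> {1..}" "card B \<le> k" and ex: "exchangeable B"
  shows "family_norm (x - proj A x) \<le> family_norm (x - proj B x)"
proof -
  have A': "finite A" "A \<subseteq> {1..}" "card A = k"
    and greedy: "\<And>i j. i \<in> A \<Longrightarrow> j \<in> {1..} - A \<Longrightarrow> norm (x j) \<le> norm (x i)"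
    using A by (auto simp: greedy_set_def coord_def)
  show ?thesis
  proof (rule residual_norm_least[OF A'(1,2) x])
    fix F assume F: "F \<in> \<F>"
    have fin: "finite F" by (rule finite_member[OF F])
    (* The coordinates of F that survive in the residual of A but not in that of B. *)
    define P where "P = F \<inter> B - A"
    have P: "finite P" "P \<subseteq> {1..} - A"
      using fin B by (auto simp: P_def)
    have "card P \<le> card (B - A)"
      using B by (intro card_mono) (auto simp: P_def)
    also have "\<dots> \<le> card (A - B)"
      using A' B by (intro card_le_sym_Diff) auto
    finally obtain H where H: "H \<subseteq> A - B" "card H = card P"
      using obtain_subset_with_card_n by metis
    have finH: "finite H"
      using H(1) A'(1) by (meson finite_Diff finite_subset)
    obtain \<phi> where \<phi>: "bij_betw \<phi> P H"
      using finite_same_card_bij[OF P(1) finH] H(2) by metis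
    have "card H \<le> card (F \<inter> B)"
      unfolding H(2) P_def using fin by (intro card_mono) auto
    then obtain G where G: "G \<in> \<F>" "(F - B) \<union> H \<subseteq> G"
      using ex F H(1) A'(2) finH unfolding exchangeable_def by (meson Diff_mono order_refl subset_trans)
    have "(\<Sum>i\<in>P. norm (x i)) \<le> (\<Sum>i\<in>P. norm (x (\<phi> i)))"
      using P(2) H(1) bij_betwE[OF \<phi>] by (intro sum_mono greedy) auto
    also have "\<dots> = (\<Sum>i\<in>H. norm (x i))"
      using \<phi> by (rule sum.reindex_bij_betw)
    finally have PH: "(\<Sum>i\<in>P. norm (x i)) \<le> (\<Sum>i\<in>H. norm (x i))" .
    have "F - A = (F - A - B) \<union> P"
      by (auto simp: P_def)
    then have "(\<Sum>i\<in>F - A. norm (x i)) = (\<Sum>i\<in>(F - A - B) \<union> P. norm (x i))"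
      by simp
    also have "\<dots> = (\<Sum>i\<in>F - A - B. norm (x i)) + (\<Sum>i\<in>P. norm (x i))"
      using fin P(1) by (intro sum.union_disjoint) (auto simp: P_def)
    also have "\<dots> \<le> (\<Sum>i\<in>F - A - B. norm (x i)) + (\<Sum>i\<in>H. norm (x i))"
      using PH by simp
    also have "\<dots> = (\<Sum>i\<in>(F - A - B) \<union> H. norm (x i))"
      using fin finH H(1) by (intro sum.union_disjoint[symmetric]) auto
    also have "\<dots> \<le> family_norm (x - proj B x)"
      using G H(1) by (intro sum_le_residual_norm[OF B(1,2) x G(1)]) auto
    finally show "(\<Sum>i\<in>F - A. norm (x i)) \<le> family_norm (x - proj B x)" .
  qed
qed

text \<open>Almost greediness compares indicators: for disjoint \<open>A\<close> and \<open>B\<close> of the same size, the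
  vector with coefficients \<open>1\<close> on \<open>A \<union> B\<close> has \<open>A\<close> as a greedy set, so removing \<open>A\<close> must not be
  much worse than removing \<open>B\<close>.\<close>

lemma not_almost_greedyI:
  assumes m: "pos_index_seq m"
    and bad: "\<And>C. C \<ge> 1 \<Longrightarrow> \<exists>A B F a. finite A \<and> finite B \<and> A \<subseteq> {1..} \<and> B \<subseteq> seq_terms m \<and> A \<inter> B = {} \<and>
      card A = card B \<and> F \<in> \<F> \<and> (\<forall>G\<in>\<F>. real (card (G \<inter> A)) \<le> a) \<and> C * a < card (F \<inter> B)"
  shows "\<not> banach_basis.almost_greedy
    (pointwise_scale :: 'k::{real_normed_field, banach, second_countable_topology} \<Rightarrow> _)
    family_space family_norm unit_seq coord m"
proof
  assume "banach_basis.almost_greedy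
    (pointwise_scale :: 'k \<Rightarrow> _) family_space family_norm unit_seq coord m"
  then obtain C where C: "C \<ge> 1" and ag: "\<And>(x :: nat \<Rightarrow> 'k) k A. x \<in> family_space \<Longrightarrow> k \<ge> 1 \<Longrightarrow>
      greedy_set x k A \<Longrightarrow> family_norm (x - proj A x) \<le> C * sigma_tilde m k x"
    unfolding almost_greedy_def by blast
  obtain A B F a where AB: "finite A" "finite B" "A \<subseteq> {1..}" "B \<subseteq> seq_terms m" "A \<inter> B = {}" "card A = card B"
    and F: "F \<in> \<F>" and a: "\<And>G. G \<in> \<F> \<Longrightarrow> real (card (G \<inter> A)) \<le> a" and less: "C * a < card (F \<inter> B)"
    using bad[OF C] by blast
  have B1: "B \<subseteq> {1..}"
    using AB(4) pos_index_seq_terms(1)[OF m] by blast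
  define x :: "nat \<Rightarrow> 'k" where "x = (\<lambda>i. if i \<in> A \<union> B then 1 else 0)"
  obtain N where N: "\<And>i. i \<in> A \<union> B \<Longrightarrow> i < N"
    using AB(1,2) by (metis finite_UnI finite_nat_bounded lessThan_iff subsetD)
  have x: "x \<in> family_space"
    using AB(3) B1 N by (intro family_space_finite_support[of _ N]) (force simp: x_def)+
  have "0 \<le> a"
    using a[OF F] by (meson of_nat_0_le_iff order_trans)
  then have "F \<inter> B \<noteq> {}"
    using less C by (auto simp: mult_less_0_iff)
  then have k: "card B \<ge> 1"
    using AB(2) by (metis One_nat_def Suc_leI card_gt_0_iff inf_bot_right)
  have "greedy_set x (card B) A"
    using AB unfolding greedy_set_def by (auto simp: coord_def x_def)
  then have "family_norm (x - proj A x) \<le> C * sigma_tilde m (card B) x"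
    by (rule ag[OF x k])
  also have "\<dots> \<le> C * family_norm (x - proj B x)"
    using C AB by (intro mult_left_mono sigma_tilde_le[OF m x]) auto
  also have "\<dots> \<le> C * a"
  proof (intro mult_left_mono residual_norm_least[OF AB(2) B1 x])
    fix G assume G: "G \<in> \<F>"
    have "(\<Sum>i\<in>G - B. norm (x i)) = (\<Sum>i\<in>G \<inter> A. 1)"
      using finite_member[OF G] AB(5) by (intro sum.mono_neutral_cong_right) (auto simp: x_def)
    then show "(\<Sum>i\<in>G - B. norm (x i)) \<le> a"
      using a[OF G] by simp
  qed (use C in simp)
  also have "\<dots> < (\<Sum>i\<in>F \<inter> B. norm (x i))"
    using less by (simp add: x_def)
  also have "\<dots> \<le> family_norm (x - proj A x)"
    using AB(5) by (intro sum_le_residual_norm[OF AB(1,3) x F]) auto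
  finally show False by simp
qed

end


section \<open>The two examples\<close>

text \<open>The norm of this family is the maximum of the \<open>\<ell>\<^sub>1\<close>-norm on \<open>M\<close> and the supremum norm, so
  the space is \<open>\<ell>\<^sub>1(M) \<oplus> c\<^sub>0\<close>.\<close>

definition l1_c0_family :: "nat set \<Rightarrow> nat set set" where
  "l1_c0_family M = {F. finite F \<and> F \<subseteq> M \<inter> {1..}} \<union> (\<lambda>i. {i}) ` {1..}"

interpretation l1_c0: index_family "l1_c0_family M" for M
  by unfold_locales (auto simp: l1_c0_family_def)

text \<open>A subset of \<open>M\<close> does not meet \<open>B\<close>, so nothing has to be exchanged, and a singleton is
  exchanged for a singleton.\<close>

lemma l1_c0_exchangeable:
  assumes "B \<inter> M = {}"
  shows "l1_c0.exchangeable M B"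
  unfolding l1_c0.exchangeable_def
proof (intro ballI allI impI)
  fix F H assume F: "F \<in> l1_c0_family M" and H: "H \<subseteq> {1..} - B" "finite H" "card H \<le> card (F \<inter> B)"
  show "\<exists>G\<in>l1_c0_family M. F - B \<union> H \<subseteq> G"
  proof (cases "F \<inter> B = {}")
    case True
    with H F show ?thesis by auto
  next
    case False
    then obtain i where i: "F = {i}" "i \<in> B"
      using F assms by (auto simp: l1_c0_family_def)
    obtain h where "h \<ge> 1" "H \<subseteq> {h}"
    proof (cases "H = {}")
      case False
      then have "card H = 1"
        using H i by (simp add: le_Suc_eq)
      then show thesis
        using H(1) that by (auto simp: card_1_singleton_iff)
    qed (use that in auto)
    then show ?thesis
      using i by (intro bexI[of _ "{h}"]) (auto simp: l1_c0_family_def)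
  qed
qed

lemma l1_c0_almost_greedy:
  assumes n: "pos_index_seq n" and "M \<inter> seq_terms n = {}"
  shows "banach_basis.almost_greedy
    (l1_c0.pointwise_scale :: 'k::{real_normed_field, banach, second_countable_topology} \<Rightarrow> _)
    (l1_c0.family_space M) (l1_c0.family_norm M) l1_c0.unit_seq l1_c0.coord n"
  unfolding l1_c0.almost_greedy_def
proof (intro exI[of _ 1] conjI ballI allI impI)
  fix x :: "nat \<Rightarrow> 'k" and k A
  assume x: "x \<in> l1_c0.family_space M" and A: "l1_c0.greedy_set x k A"
  have "l1_c0.family_norm M (x - l1_c0.proj A x) \<le> l1_c0.sigma_tilde M n k x"
  proof (rule l1_c0.sigma_tilde_greatest[OF n])
    fix B assume "B \<subseteq> seq_terms n" "finite B" "card B = k"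
    then show "l1_c0.family_norm M (x - l1_c0.proj A x) \<le> l1_c0.family_norm M (x - l1_c0.proj B x)"
      using pos_index_seq_terms(1)[OF n] assms(2)
      by (intro l1_c0.greedy_le_exchangeable[OF x A] l1_c0_exchangeable) auto
  qed
  then show "l1_c0.family_norm M (x - l1_c0.proj A x) \<le> 1 * l1_c0.sigma_tilde M n k x"
    by simp
qed simp

text \<open>Indicators of nonempty finite subsets of \<open>seq_terms n\<close> have norm \<open>1\<close>, while for subsets of
  \<open>M\<close> the norm is the size.\<close>

lemma l1_c0_not_almost_greedy:
  assumes m: "pos_index_seq m" and n: "pos_index_seq n" and inf: "infinite (seq_terms m \<inter> M)"
    and M: "M \<inter> seq_terms n = {}"
  shows "\<not> banach_basis.almost_greedy
    (l1_c0.pointwise_scale :: 'k::{real_normed_field, banach, second_countable_topology} \<Rightarrow> _)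
    (l1_c0.family_space M) (l1_c0.family_norm M) l1_c0.unit_seq l1_c0.coord m"
proof (rule l1_c0.not_almost_greedyI[OF m])
  fix C :: real
  obtain q :: nat where q: "C < q"
    using reals_Archimedean2 by blast
  obtain A where A: "finite A" "card A = q" "A \<subseteq> seq_terms n"
    using infinite_arbitrarily_large[OF pos_index_seq_terms(3)[OF n]] by metis
  obtain B where B: "finite B" "card B = q" "B \<subseteq> seq_terms m \<inter> M"
    using infinite_arbitrarily_large[OF inf] by metis
  have pos: "A \<subseteq> {1..}" "B \<subseteq> {1..}"
    using A B pos_index_seq_terms(1)[OF m] pos_index_seq_terms(1)[OF n] by auto
  have disj: "A \<inter> M = {}"
    using A(3) M by auto
  have "card (G \<inter> A) \<le> 1" if "G \<in> l1_c0_family M" for G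
  proof (cases "G \<subseteq> M")
    case True
    then have "G \<inter> A = {}"
      using disj by auto
    then show ?thesis by simp
  next
    case False
    then have "\<exists>i. G = {i}"
      using that unfolding l1_c0_family_def by blast
    then obtain i where "G \<inter> A \<subseteq> {i}"
      by blast
    then show ?thesis
      using card_mono[of "{i}" "G \<inter> A"] by simp
  qed
  moreover have "B \<in> l1_c0_family M"
    using B pos by (auto simp: l1_c0_family_def)
  ultimately show "\<exists>A B F a. finite A \<and> finite B \<and> A \<subseteq> {1..} \<and> B \<subseteq> seq_terms m \<and> A \<inter> B = {} \<and>
      card A = card B \<and> F \<in> l1_c0_family M \<and> (\<forall>G\<in>l1_c0_family M. real (card (G \<inter> A)) \<le> a) \<and>
      C * a < card (F \<inter> B)"
    using A B pos disj q
    by (intro exI[of _ A] exI[of _ B] exI[of _ B] exI[of _ 1]) auto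
qed

text \<open>A Schreier family in which the rank of an index in the sequence \<open>n\<close> takes the place of the
  index itself; indices outside the sequence have infinite rank and impose no restriction.  A
  set is admissible if its size is at most the square root of each rank.  With
  the rank in place of its root, the indicator of any set would have norm comparable to the size
  of the set, and the comparison of indicators would not refute almost greediness.\<close>

definition seq_schreier_family :: "(nat \<Rightarrow> nat) \<Rightarrow> nat set set" where
  "seq_schreier_family n = {F. finite F \<and> F \<subseteq> {1..} \<and> (\<forall>k\<ge>1. n k \<in> F \<longrightarrow> (card F)\<^sup>2 \<le> k)}"

interpretation schreier: index_family "seq_schreier_family n" for n
  by unfold_locales (auto simp: seq_schreier_family_def)

text \<open>Away from the first \<open>k\<close> terms of the sequence all ranks exceed \<open>k\<close>, so an exchange moves
  indices to higher rank without increasing the size of the set.\<close>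

lemma schreier_exchangeable:
  "schreier.exchangeable n (n ` {1..k})"
  unfolding schreier.exchangeable_def
proof (intro ballI allI impI)
  let ?B = "n ` {1..k}"
  fix F H assume F: "F \<in> seq_schreier_family n"
    and H: "H \<subseteq> {1..} - ?B" "finite H" "card H \<le> card (F \<inter> ?B)"
  have F': "finite F" "F \<subseteq> {1..}" "\<And>l. l \<ge> 1 \<Longrightarrow> n l \<in> F \<Longrightarrow> (card F)\<^sup>2 \<le> l"
    using F by (auto simp: seq_schreier_family_def)
  show "\<exists>G\<in>seq_schreier_family n. F - ?B \<union> H \<subseteq> G"
  proof (cases "F \<inter> ?B = {}")
    case True
    with H F show ?thesis by auto
  next
    case False
    then obtain j where j: "1 \<le> j" "j \<le> k" "n j \<in> F"
      by auto
    have "card (F - ?B \<union> H) \<le> card (F - ?B) + card (F \<inter> ?B)"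
      using card_Un_le[of "F - ?B" H] H(3) by linarith
    also have "\<dots> = card F"
      using card_Int_Diff[OF F'(1), of ?B] by simp
    finally have card: "(card (F - ?B \<union> H))\<^sup>2 \<le> (card F)\<^sup>2"
      by (rule power_mono) simp
    have "(card (F - ?B \<union> H))\<^sup>2 \<le> l" if l: "l \<ge> 1" "n l \<in> F - ?B \<union> H" for l
    proof (cases "n l \<in> F")
      case True
      then show ?thesis
        using F'(3)[OF l(1)] card by linarith
    next
      case False
      then have "n l \<notin> ?B"
        using l H(1) by auto
      then have "k < l"
        using l(1) by (auto simp: not_le[symmetric])
      then show ?thesis
        using F'(3)[OF j(1,3)] j(2) card by linarith
    qed
    then have "F - ?B \<union> H \<in> seq_schreier_family n"
      unfolding seq_schreier_family_def using F'(1,2) H(1,2) by auto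
    then show ?thesis by blast
  qed
qed

lemma schreier_one_strong_partially_greedy:
  assumes n: "pos_index_seq n"
  shows "banach_basis.one_strong_partially_greedy
    (schreier.pointwise_scale :: 'k::{real_normed_field, banach, second_countable_topology} \<Rightarrow> _)
    (schreier.family_space n) (schreier.family_norm n) schreier.unit_seq schreier.coord n"
  unfolding schreier.one_strong_partially_greedy_def
proof (intro ballI allI impI Min.boundedI)
  fix x :: "nat \<Rightarrow> 'k" and m A r
  assume x: "x \<in> schreier.family_space n" and A: "schreier.greedy_set x m A"
    and "r \<in> (\<lambda>k. schreier.family_norm n (x - schreier.partial_proj n k x)) ` {0..m}"
  then obtain k where k: "k \<le> m" "r = schreier.family_norm n (x - schreier.proj (n ` {1..k}) x)"
    by (auto simp: schreier.partial_proj_eq_proj[OF n])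
  have "n ` {1..k} \<subseteq> {1..}"
    using n by (auto simp: pos_index_seq_def)
  moreover have "card (n ` {1..k}) \<le> m"
    using card_image_le[of "{1..k}" n] k(1) by simp
  ultimately show "schreier.family_norm n (x - schreier.proj A x) \<le> r"
    unfolding k(2) by (intro schreier.greedy_le_exchangeable[OF x A] schreier_exchangeable) auto
qed auto

text \<open>The indicator of the first \<open>q\<^sup>2\<close> terms has norm at most \<open>q\<close>, since an admissible set that
  meets them has size at most \<open>q\<close>.  A block of \<open>q\<^sup>2\<close> terms with ranks above \<open>q\<^sup>4\<close> is itself
  admissible, so its indicator has norm \<open>q\<^sup>2\<close>.\<close>

lemma schreier_not_almost_greedy:
  assumes n: "pos_index_seq n"
  shows "\<not> banach_basis.almost_greedy
    (schreier.pointwise_scale :: 'k::{real_normed_field, banach, second_countable_topology} \<Rightarrow> _)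
    (schreier.family_space n) (schreier.family_norm n) schreier.unit_seq schreier.coord n"
proof (rule schreier.not_almost_greedyI[OF n])
  fix C :: real assume C: "C \<ge> 1"
  obtain q :: nat where q: "C < q"
    using reals_Archimedean2 by blast
  then have q1: "q \<ge> 1"
    using C by (cases q) auto
  define A where "A = n ` {1..q\<^sup>2}"
  define B where "B = n ` {(q\<^sup>2)\<^sup>2 + 1..(q\<^sup>2)\<^sup>2 + q\<^sup>2}"
  have inj: "inj_on n {1..}"
    by (rule pos_index_seq_terms(2)[OF n])
  have card: "card A = q\<^sup>2" "card B = q\<^sup>2"
    unfolding A_def B_def by (subst card_image; auto intro: inj_on_subset[OF inj])+
  have pos: "A \<subseteq> {1..}" "B \<subseteq> {1..}" "B \<subseteq> seq_terms n"
    using n by (auto simp: A_def B_def seq_terms_def pos_index_seq_def)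
  have "q\<^sup>2 \<le> (q\<^sup>2)\<^sup>2"
    using q1 by (simp add: power2_nat_le_imp_le power2_eq_square)
  then have "{1..q\<^sup>2} \<inter> {(q\<^sup>2)\<^sup>2 + 1..(q\<^sup>2)\<^sup>2 + q\<^sup>2} = {}"
    by auto
  then have disj: "A \<inter> B = {}"
    unfolding A_def B_def by (subst inj_on_image_Int[OF inj, symmetric]) auto
  have "real (card (G \<inter> A)) \<le> q" if G: "G \<in> seq_schreier_family n" for G
  proof (cases "G \<inter> A = {}")
    case False
    then obtain k where k: "1 \<le> k" "k \<le> q\<^sup>2" "n k \<in> G"
      by (auto simp: A_def)
    have "(card G)\<^sup>2 \<le> k"
      using G k unfolding seq_schreier_family_def by blast
    then have "(card G)\<^sup>2 \<le> q\<^sup>2"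
      using k(2) by linarith
    then have "card G \<le> q"
      by (rule power2_le_imp_le) simp
    moreover have "card (G \<inter> A) \<le> card G"
      using G by (intro card_mono) (auto simp: seq_schreier_family_def)
    ultimately show ?thesis by simp
  qed simp
  moreover have "B \<in> seq_schreier_family n"
  proof -
    have "(q\<^sup>2)\<^sup>2 \<le> k" if k: "k \<ge> 1" "n k \<in> B" for k
    proof -
      obtain j where j: "j \<ge> (q\<^sup>2)\<^sup>2 + 1" "n k = n j"
        using k(2) by (auto simp: B_def)
      have "k = j"
        using j k(1) by (intro inj_onD[OF inj j(2)]) auto
      then show ?thesis
        using j(1) by linarith
    qed
    then show ?thesis
      using pos card by (auto simp: seq_schreier_family_def B_def)
  qed
  moreover have "C * q < real (card (B \<inter> B))"
    using q q1 by (simp add: card power2_eq_square)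
  ultimately show "\<exists>A B F a. finite A \<and> finite B \<and> A \<subseteq> {1..} \<and> B \<subseteq> seq_terms n \<and> A \<inter> B = {} \<and>
      card A = card B \<and> F \<in> seq_schreier_family n \<and>
      (\<forall>G\<in>seq_schreier_family n. real (card (G \<inter> A)) \<le> a) \<and> C * a < card (F \<inter> B)"
    using pos disj card
    by (intro exI[of _ A] exI[of _ B] exI[of _ B] exI[of _ "real q"]) (auto simp: A_def B_def)
qed


section \<open>Comparison of the greedy-type properties\<close>

theorem proposition6p4:
  fixes m n :: "nat \<Rightarrow> nat"
  assumes "pos_index_seq m" and "pos_index_seq n"
  shows
    "(infinite (seq_terms m - seq_terms n) \<longrightarrow>
        (\<exists>(scale :: real \<Rightarrow> (nat \<Rightarrow> real) \<Rightarrow> (nat \<Rightarrow> real)) V nrm e es.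
           banach_basis scale V nrm e es \<and>
           banach_basis.almost_greedy scale V nrm e es n \<and>
           \<not> banach_basis.almost_greedy scale V nrm e es m) \<and>
        (\<exists>(scale :: complex \<Rightarrow> (nat \<Rightarrow> complex) \<Rightarrow> (nat \<Rightarrow> complex)) V nrm e es.
           banach_basis scale V nrm e es \<and>
           banach_basis.almost_greedy scale V nrm e es n \<and>
           \<not> banach_basis.almost_greedy scale V nrm e es m)) \<and>
     (finite (seq_terms m - seq_terms n) \<longrightarrow>
        (\<forall>(scale :: real \<Rightarrow> 'v::ab_group_add \<Rightarrow> 'v) V nrm e es.
           banach_basis scale V nrm e es \<longrightarrow>
           banach_basis.almost_greedy scale V nrm e es n \<longrightarrow>
           banach_basis.almost_greedy scale V nrm e es m) \<and>
        (\<forall>(scale :: complex \<Rightarrow> 'w::ab_group_add \<Rightarrow> 'w) V nrm e es.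
           banach_basis scale V nrm e es \<longrightarrow>
           banach_basis.almost_greedy scale V nrm e es n \<longrightarrow>
           banach_basis.almost_greedy scale V nrm e es m)) \<and>
     ((\<exists>(scale :: real \<Rightarrow> (nat \<Rightarrow> real) \<Rightarrow> (nat \<Rightarrow> real)) V nrm e es.
         banach_basis scale V nrm e es \<and>
         banach_basis.one_strong_partially_greedy scale V nrm e es n \<and>
         \<not> banach_basis.almost_greedy scale V nrm e es n) \<and>
      (\<exists>(scale :: complex \<Rightarrow> (nat \<Rightarrow> complex) \<Rightarrow> (nat \<Rightarrow> complex)) V nrm e es.
         banach_basis scale V nrm e es \<and>
         banach_basis.one_strong_partially_greedy scale V nrm e es n \<and>
         \<not> banach_basis.almost_greedy scale V nrm e es n))"
proof (intro conjI impI allI)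
  note l1_c0 = l1_c0.banach_basis_axioms
    l1_c0_almost_greedy[OF assms(2), of "seq_terms m - seq_terms n"]
    l1_c0_not_almost_greedy[OF assms, of "seq_terms m - seq_terms n"]
  have diff: "(seq_terms m - seq_terms n) \<inter> seq_terms n = {}"
    "seq_terms m \<inter> (seq_terms m - seq_terms n) = seq_terms m - seq_terms n"
    by auto
  assume inf: "infinite (seq_terms m - seq_terms n)"
  show "\<exists>(scale :: real \<Rightarrow> (nat \<Rightarrow> real) \<Rightarrow> (nat \<Rightarrow> real)) V nrm e es.
           banach_basis scale V nrm e es \<and>
           banach_basis.almost_greedy scale V nrm e es n \<and>
           \<not> banach_basis.almost_greedy scale V nrm e es m"
    using l1_c0 inf unfolding diff by blast
  show "\<exists>(scale :: complex \<Rightarrow> (nat \<Rightarrow> complex) \<Rightarrow> (nat \<Rightarrow> complex)) V nrm e es.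
           banach_basis scale V nrm e es \<and>
           banach_basis.almost_greedy scale V nrm e es n \<and>
           \<not> banach_basis.almost_greedy scale V nrm e es m"
    using l1_c0 inf unfolding diff by blast
next
  fix scale :: "real \<Rightarrow> 'v \<Rightarrow> 'v" and V nrm e es
  assume "finite (seq_terms m - seq_terms n)" "banach_basis scale V nrm e es"
    "banach_basis.almost_greedy scale V nrm e es n"
  then show "banach_basis.almost_greedy scale V nrm e es m"
    using banach_basis.almost_greedy_finite_difference assms by blast
next
  fix scale :: "complex \<Rightarrow> 'w \<Rightarrow> 'w" and V nrm e es
  assume "finite (seq_terms m - seq_terms n)" "banach_basis scale V nrm e es"
    "banach_basis.almost_greedy scale V nrm e es n"
  then show "banach_basis.almost_greedy scale V nrm e es m"
    using banach_basis.almost_greedy_finite_difference assms by blast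
next
  note schreier = schreier.banach_basis_axioms schreier_one_strong_partially_greedy[OF assms(2)]
    schreier_not_almost_greedy[OF assms(2)]
  show "\<exists>(scale :: real \<Rightarrow> (nat \<Rightarrow> real) \<Rightarrow> (nat \<Rightarrow> real)) V nrm e es.
         banach_basis scale V nrm e es \<and>
         banach_basis.one_strong_partially_greedy scale V nrm e es n \<and>
         \<not> banach_basis.almost_greedy scale V nrm e es n"
    using schreier by blast
  show "\<exists>(scale :: complex \<Rightarrow> (nat \<Rightarrow> complex) \<Rightarrow> (nat \<Rightarrow> complex)) V nrm e es.
         banach_basis scale V nrm e es \<and>
         banach_basis.one_strong_partially_greedy scale V nrm e es n \<and>
         \<not> banach_basis.almost_greedy scale V nrm e es n"
    using schreier by blast
qed

end
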